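(* Let $G$ be a finite simple undirected graph. Then $G$ is chordal if and only if $\operatorname{ML-degree}(G)=1$.
   Context: Let $G=(V,E)$ be a finite simple undirected graph with $V=[n]=\{1,\dots,n\}$. Let $S^2(\mathbb{C}^n)$ be the space of complex symmetric $n\times n$ matrices. $L_G\subset S^2(\mathbb{C}^n)$ is the linear space of symmetric matrices $M$ with $M_{ij}=0$ whenever $i\neq j$ and $\{i,j\}\notin E$. $L_G^{-1}$ is the closure in $S^2(\mathbb{C}^n)$ of the set of inverses of invertible matrices in $L_G$. $L_G^{\perp}$ is the orthogonal complement of $L_G$ with respect to the bilinear trace form $(A,B)\mapsto \operatorname{tr}(AB)$, i.e. the symmetric matrices that vanish on the diagonal and at all positions $(i,j)$ with $\{i,j\}\in E$. The ML-degree of $G$ is the number of points of $(S+L_G^{\perp})\cap L_G^{-1}$ for a generic symmetric matrix $S\in S^2(\mathbb{C}^n)$ (this number does not depend on the generic choice of $S$). Equivalently, it is the number of complex critical points of the log-likelihood function $\ell(\Sigma)=\log\det(\Sigma^{-1})-\operatorname{tr}(S\Sigma^{-1})$ of the Gaussian graphical model of $G$ (matrices $\Sigma$ with $\Sigma^{-1}\in L_G$) for generic $S$. A graph $G$ is chordal (decomposable) if every cycle of length at least $4$ in $G$ has a chord; equivalently, no induced subgraph of $G$ is a cycle of length at least $4$. *)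

theory Defs
  imports "HOL-Analysis.Analysis"
begin

(* A graph on the vertex set UNIV :: 'n set, of size n = CARD('n), is given by its set of
   edges, each edge being the unordered pair {i, j} of its two distinct ends. *)
definition simple_graph :: "'n::finite set set \<Rightarrow> bool" where
  "simple_graph E \<longleftrightarrow> (\<forall>e\<in>E. card e = 2)"

(* The list enumerates the vertices of the cycle; the last vertex is joined to the first. *)
definition cycle_edges :: "'n list \<Rightarrow> 'n set set" where
  "cycle_edges vs = {{vs ! i, vs ! (Suc i mod length vs)} | i. i < length vs}"

definition cycle_in :: "'n set set \<Rightarrow> 'n list \<Rightarrow> bool" where
  "cycle_in E vs \<longleftrightarrow> length vs \<ge> 3 \<and> distinct vs \<and> cycle_edges vs \<subseteq> E"

definition has_chord :: "'n set set \<Rightarrow> 'n list \<Rightarrow> bool" where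
  "has_chord E vs \<longleftrightarrow> (\<exists>u\<in>set vs. \<exists>v\<in>set vs. {u, v} \<in> E \<and> {u, v} \<notin> cycle_edges vs)"

definition chordal :: "'n set set \<Rightarrow> bool" where
  "chordal E \<longleftrightarrow> (\<forall>vs. cycle_in E vs \<and> length vs \<ge> 4 \<longrightarrow> has_chord E vs)"

definition sym_matrices :: "(complex^'n^'n) set" where
  "sym_matrices = {M. transpose M = M}"

definition L_space :: "'n set set \<Rightarrow> (complex^'n^'n) set" where
  "L_space E = {M \<in> sym_matrices. \<forall>i j. i \<noteq> j \<and> {i, j} \<notin> E \<longrightarrow> M $ i $ j = 0}"

(* The closure is taken in the Euclidean topology. The set of inverses is constructible, so
   its Zariski closure is the same; and the symmetric matrices are closed, so it does not
   matter that the closure is formed in the space of all matrices. *)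
definition L_inverse :: "'n::finite set set \<Rightarrow> (complex^'n^'n) set" where
  "L_inverse E = closure {matrix_inv K | K. K \<in> L_space E \<and> invertible K}"

definition L_perp :: "'n::finite set set \<Rightarrow> (complex^'n^'n) set" where
  "L_perp E = {B \<in> sym_matrices. \<forall>A \<in> L_space E. trace (A ** B) = 0}"

inductive matrix_polynomial :: "(complex^'n^'n \<Rightarrow> complex) \<Rightarrow> bool" where
  const: "matrix_polynomial (\<lambda>M. c)"
| entry: "matrix_polynomial (\<lambda>M. M $ i $ j)"
| add: "matrix_polynomial p \<Longrightarrow> matrix_polynomial q \<Longrightarrow> matrix_polynomial (\<lambda>M. p M + q M)"
| mult: "matrix_polynomial p \<Longrightarrow> matrix_polynomial q \<Longrightarrow> matrix_polynomial (\<lambda>M. p M * q M)"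

(* Q holds on a nonempty Zariski-open subset of the space of symmetric matrices; such a set
   always contains one of the form {S. p S ~= 0} with p not identically zero there. *)
definition for_generic_sym :: "(complex^'n^'n \<Rightarrow> bool) \<Rightarrow> bool" where
  "for_generic_sym Q \<longleftrightarrow>
     (\<exists>p. matrix_polynomial p \<and> (\<exists>S\<in>sym_matrices. p S \<noteq> 0) \<and>
          (\<forall>S\<in>sym_matrices. p S \<noteq> 0 \<longrightarrow> Q S))"

definition critical_points :: "'n::finite set set \<Rightarrow> complex^'n^'n \<Rightarrow> (complex^'n^'n) set" where
  "critical_points E S = {S + B | B. B \<in> L_perp E} \<inter> L_inverse E"

definition has_ml_degree :: "'n::finite set set \<Rightarrow> nat \<Rightarrow> bool" where
  "has_ml_degree E d \<longleftrightarrow>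
     for_generic_sym (\<lambda>S. finite (critical_points E S) \<and> card (critical_points E S) = d)"

(* At most one d satisfies has_ml_degree E d, because two nonempty Zariski-open sets of
   symmetric matrices meet. That some d does is a theorem of algebraic geometry; the value 0
   in the other case only makes the function total, so that ml_degree E = 1 holds exactly
   when has_ml_degree E 1 does. *)
definition ml_degree :: "'n::finite set set \<Rightarrow> nat" where
  "ml_degree E = (if \<exists>d. has_ml_degree E d then THE d. has_ml_degree E d else 0)"

end

theory Submission
  imports Defs
begin

text \<open>If the graph is chordal, eliminate the vertices in a perfect elimination ordering: the inverses satisfy
  polynomial regression equations that express every entry off the graph through the entries on the graph, rationally
  in generic \<^term>\<open>S\<close>, and conversely the regression coefficients of \<^term>\<open>S\<close> yield a critical point.

  If the graph has a chordless cycle of length \<^term>\<open>m \<ge> 4\<close>, then the identity matrix has a critical point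
  other than itself: a limit of inverses of circulant matrices supported on the cycle, at a parameter \<^term>\<open>r\<close> with
  \<^term>\<open>r ^ (m - 2) = -1\<close>. A perturbation of it is a critical point of generic matrices whose entries on the graph
  are close to those of the identity, and these matrices also have a critical point near the identity.\<close>

section \<open>Matrix polynomials\<close>

text \<open>The exponent m - 2 comes from the shape of the circulants: at distance e along the cycle
  their entries are proportional to r ^ e + r ^ (m - e). At distance 1 this is r * (1 + r ^ (m -
  2)), so the condition on r kills the entries on the cycle edges, while an entry at distance 2
  survives. For m = 4 the limit matrix is singular, a point of the closure that is not itself an
  inverse. The polynomial that cuts out the generic matrices is arbitrary and may vanish at the
  identity, so both critical points have to be moved. Adding a matrix that vanishes on the graph
  keeps all graph entries, and a line in \<open>L_space E\<close> joins any two invertible members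
  by a rational curve of inverses. Nonvanishing of the polynomial at one translated inverse
  therefore spreads to translates of inverses arbitrarily close to the second critical point. In the
  chordal direction, elimination yields the regressions only where no pivot vanishes. Their cleared
  form is a polynomial identity, which continues to all inverses and to limits of inverses.\<close>

lemma matrix_polynomial_sum:
  "finite A \<Longrightarrow> (\<And>a. a \<in> A \<Longrightarrow> matrix_polynomial (f a)) \<Longrightarrow> matrix_polynomial (\<lambda>M. \<Sum>a\<in>A. f a M)"
  by (induction A rule: finite_induct) (simp_all add: matrix_polynomial.const matrix_polynomial.add)

lemma matrix_polynomial_prod:
  "finite A \<Longrightarrow> (\<And>a. a \<in> A \<Longrightarrow> matrix_polynomial (f a)) \<Longrightarrow> matrix_polynomial (\<lambda>M. \<Prod>a\<in>A. f a M)"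
  by (induction A rule: finite_induct) (simp_all add: matrix_polynomial.const matrix_polynomial.mult)

lemma matrix_polynomial_diff:
  assumes "matrix_polynomial p" "matrix_polynomial q"
  shows "matrix_polynomial (\<lambda>M. p M - q M)"
  using matrix_polynomial.add[OF assms(1) matrix_polynomial.mult[OF matrix_polynomial.const[of "-1"] assms(2)]]
  by simp

lemma matrix_polynomial_det:
  fixes F :: "complex^'n^'n \<Rightarrow> complex^'m^'m"
  assumes "\<And>i j. matrix_polynomial (\<lambda>M. F M $ i $ j)"
  shows "matrix_polynomial (\<lambda>M. det (F M))"
  unfolding det_def
  by (intro matrix_polynomial_sum matrix_polynomial.mult matrix_polynomial.const
      matrix_polynomial_prod assms) (simp_all add: finite_permutations)

lemma continuous_matrix_polynomial:
  "matrix_polynomial p \<Longrightarrow> continuous_on UNIV p"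
  by (induction rule: matrix_polynomial.induct) (auto intro!: continuous_intros)

text \<open>The hypothesis says that the entries of \<^term>\<open>G t\<close> are rational functions with denominator \<^term>\<open>d\<close>.\<close>
lemma matrix_polynomial_along_curve:
  fixes G :: "complex \<Rightarrow> complex^'n^'n"
  assumes "matrix_polynomial p"
    and G: "\<And>i j. \<exists>g. \<forall>t\<in>T. G t $ i $ j * poly d t = poly g t"
  shows "\<exists>N q. \<forall>t\<in>T. p (G t) * poly d t ^ N = poly q t"
  using assms(1)
proof induction
  case (const c)
  show ?case by (intro exI[of _ 0] exI[of _ "[:c:]"]) simp
next
  case (entry i j)
  obtain g where "\<forall>t\<in>T. G t $ i $ j * poly d t = poly g t" using G by blast
  then show ?case by (intro exI[of _ 1] exI[of _ g]) simp
next
  case (add p1 p2)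
  then obtain N1 q1 N2 q2
    where *: "\<forall>t\<in>T. p1 (G t) * poly d t ^ N1 = poly q1 t" "\<forall>t\<in>T. p2 (G t) * poly d t ^ N2 = poly q2 t"
    by blast
  show ?case
  proof (intro exI[of _ "N1 + N2"] exI[of _ "q1 * d ^ N2 + q2 * d ^ N1"] ballI)
    fix t assume "t \<in> T"
    then have "p1 (G t) * poly d t ^ N1 = poly q1 t" "p2 (G t) * poly d t ^ N2 = poly q2 t"
      using * by auto
    then show "(p1 (G t) + p2 (G t)) * poly d t ^ (N1 + N2) = poly (q1 * d ^ N2 + q2 * d ^ N1) t"
      by (simp flip: \<open>_ = poly q1 t\<close> \<open>_ = poly q2 t\<close> add: power_add algebra_simps)
  qed
next
  case (mult p1 p2)
  then obtain N1 q1 N2 q2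
    where *: "\<forall>t\<in>T. p1 (G t) * poly d t ^ N1 = poly q1 t" "\<forall>t\<in>T. p2 (G t) * poly d t ^ N2 = poly q2 t"
    by blast
  show ?case
  proof (intro exI[of _ "N1 + N2"] exI[of _ "q1 * q2"] ballI)
    fix t assume "t \<in> T"
    then have "p1 (G t) * poly d t ^ N1 = poly q1 t" "p2 (G t) * poly d t ^ N2 = poly q2 t"
      using * by auto
    then show "p1 (G t) * p2 (G t) * poly d t ^ (N1 + N2) = poly (q1 * q2) t"
      by (simp flip: \<open>_ = poly q1 t\<close> \<open>_ = poly q2 t\<close> add: power_add algebra_simps)
  qed
qed

lemma det_along_curve:
  fixes F :: "complex \<Rightarrow> complex^'n^'n"
  assumes "\<And>i j. \<exists>g. \<forall>t. F t $ i $ j = poly g t"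
  shows "\<exists>q. \<forall>t. det (F t) = poly q t"
proof -
  obtain g where g: "\<And>i j t. F t $ i $ j = poly (g i j) t" using assms by metis
  have "det (F t) = poly (\<Sum>p\<in>{p. p permutes UNIV}. [:of_int (sign p):] * (\<Prod>i\<in>UNIV. g i (p i))) t" for t
    by (simp add: det_def g poly_sum poly_prod)
  then show ?thesis by blast
qed

section \<open>Affine lines of matrices and their inverses\<close>

definition line :: "complex^'n^'n \<Rightarrow> complex^'n^'n \<Rightarrow> complex \<Rightarrow> complex^'n^'n" where
  "line A B t = (\<chi> i j. A $ i $ j + t * (B $ i $ j - A $ i $ j))"

lemma line_nth [simp]: "line A B t $ i $ j = A $ i $ j + t * (B $ i $ j - A $ i $ j)"
  by (simp add: line_def)

lemma line_0 [simp]: "line A B 0 = A" and line_1 [simp]: "line A B 1 = B"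
  by (simp_all add: vec_eq_iff)

lemma continuous_line: "continuous_on UNIV (line A B)"
  unfolding line_def by (intro continuous_intros)

lemma line_nth_poly: "\<exists>g. \<forall>t. line A B t $ i $ j = poly g t"
  by (intro exI[of _ "[:A $ i $ j, B $ i $ j - A $ i $ j:]"]) simp

lemma matrix_polynomial_along_line:
  assumes "matrix_polynomial p"
  obtains q where "\<And>t. p (line A B t) = poly q t"
proof -
  have "\<exists>g. \<forall>t\<in>UNIV. line A B t $ i $ j * poly 1 t = poly g t" for i j
    using line_nth_poly by simp
  from matrix_polynomial_along_curve[where G = "line A B", OF assms this] that show thesis
    by auto
qed

lemma matrix_inv_inverse:
  assumes "invertible (K :: complex^'n^'n)"
  shows "K ** matrix_inv K = mat 1" "matrix_inv K ** K = mat 1"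
  using someI_ex[OF assms[unfolded invertible_def]] by (auto simp: matrix_inv_def)

lemma matrix_inv_eqI: "(K :: complex^'n^'n) ** \<Sigma> = mat 1 \<Longrightarrow> matrix_inv K = \<Sigma>"
  by (metis invertible_right_inverse matrix_inv_inverse(2) matrix_mul_assoc matrix_mul_lid matrix_mul_rid)

lemma cramer_right_inverse:
  fixes K \<Sigma> :: "complex^'n^'n"
  assumes "K ** \<Sigma> = mat 1"
  shows "\<Sigma> $ k $ l * det K = det (\<chi> i j. if j = k then (if i = l then 1 else 0) else K $ i $ j)"
proof -
  have "K *v column l \<Sigma> = column l (mat 1)"
    by (simp add: vec_eq_iff column_def matrix_vector_mult_def matrix_matrix_mult_def flip: assms)
  then have "(K *v (\<chi> i. \<Sigma> $ i $ l)) $ i = (if i = l then 1 else 0)" for i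
    by (simp add: column_def mat_def)
  then show ?thesis
    using cramer_lemma[of k K "column l \<Sigma>"] by (simp add: column_def[of l \<Sigma>] cong: if_cong)
qed

text \<open>Cramer's rule makes the inverse rational in \<open>t\<close> with denominator
  \<open>det (line A B t)\<close>, which is not identically zero because \<open>A\<close> is
  invertible. The shift \<open>C\<close> serves to evaluate \<open>p\<close> at translates of
  inverses.\<close>

lemma matrix_polynomial_inverse_line:
  assumes "matrix_polynomial p" "A ** A' = mat 1"
  obtains d N q where "d \<noteq> 0" "\<And>t. det (line A B t) = poly d t"
    "\<And>t \<Sigma>. line A B t ** \<Sigma> = mat 1 \<Longrightarrow> p (\<Sigma> + C) * poly d t ^ N = poly q t"
proof -
  obtain d where d: "\<And>t. det (line A B t) = poly d t"
    using det_along_curve[of "line A B"] line_nth_poly by blast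
  have "poly d 0 \<noteq> 0"
    using assms(2) by (metis d line_0 invertible_det_nz invertible_right_inverse)
  then have "d \<noteq> 0" by auto
  define G where "G t = matrix_inv (line A B t) + C" for t
  have "\<exists>g. \<forall>t\<in>{t. poly d t \<noteq> 0}. G t $ i $ j * poly d t = poly g t" for i j
  proof -
    define F where "F t = (\<chi> k l. if l = i then (if k = j then 1 else 0) else line A B t $ k $ l)" for t
    have "\<exists>g. \<forall>t. F t $ k $ l = poly g t" for k l
    proof (cases "l = i")
      case True
      then show ?thesis by (intro exI[of _ "if k = j then 1 else 0"]) (simp add: F_def)
    next
      case False
      then show ?thesis using line_nth_poly[of A B k l] by (simp add: F_def)
    qed
    then obtain g where g: "\<And>t. det (F t) = poly g t"
      using det_along_curve[of F] by blast
    have "G t $ i $ j * poly d t = poly (g + smult (C $ i $ j) d) t" if "poly d t \<noteq> 0" for t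
    proof -
      have "invertible (line A B t)" using that by (simp add: invertible_det_nz d)
      then have "line A B t ** matrix_inv (line A B t) = mat 1"
        by (rule matrix_inv_inverse)
      from cramer_right_inverse[OF this, of i j] show ?thesis
        by (simp add: G_def d F_def flip: g) (simp add: algebra_simps)
    qed
    then show ?thesis by blast
  qed
  from matrix_polynomial_along_curve[OF assms(1) this] obtain N q
    where q: "\<And>t. poly d t \<noteq> 0 \<Longrightarrow> p (G t) * poly d t ^ N = poly q t" by auto
  have "p (\<Sigma> + C) * poly d t ^ N = poly q t" if "line A B t ** \<Sigma> = mat 1" for t \<Sigma>
  proof -
    have inv: "invertible (line A B t)" using that invertible_right_inverse by blast
    have "\<Sigma> = matrix_inv (line A B t)"
      using that by (rule matrix_inv_eqI[symmetric])
    with q[of t] inv show ?thesis by (simp add: G_def invertible_det_nz d)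
  qed
  with \<open>d \<noteq> 0\<close> d show thesis using that by blast
qed

lemma poly_frequently_nonzero:
  fixes q :: "complex poly"
  assumes "q \<noteq> 0"
  shows "eventually (\<lambda>t. poly q t \<noteq> 0) (at a)"
proof -
  have "open (- ({t. poly q t = 0} - {a}))"
    using poly_roots_finite[OF assms] by (intro open_Compl finite_imp_closed finite_Diff)
  then have "eventually (\<lambda>t. t \<in> - ({t. poly q t = 0} - {a})) (nhds a)"
    by (intro eventually_nhds_in_open) auto
  then show ?thesis by (auto simp: eventually_at_filter elim: eventually_mono)
qed

section \<open>The set of inverses\<close>

lemma inverses_eq:
  fixes E :: "'n::finite set set"
  shows "{matrix_inv K | K. K \<in> L_space E \<and> invertible K} = {\<Sigma>. \<exists>K\<in>L_space E. K ** \<Sigma> = mat 1}"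
proof (intro set_eqI iffI; clarsimp)
  fix K assume "(K :: complex^'n^'n) \<in> L_space E" "invertible K"
  then show "\<exists>K'\<in>L_space E. K' ** matrix_inv K = mat 1" by (metis matrix_inv_inverse(1))
next
  fix K \<Sigma> assume *: "(K :: complex^'n^'n) \<in> L_space E" "K ** \<Sigma> = mat 1"
  then have "invertible K" using invertible_right_inverse by blast
  then show "\<exists>K. \<Sigma> = matrix_inv K \<and> K \<in> L_space E \<and> invertible K"
    using * matrix_inv_eqI by metis
qed

lemma sym_matrices_iff: "M \<in> sym_matrices \<longleftrightarrow> (\<forall>i j. M $ i $ j = M $ j $ i)"
  by (auto simp: sym_matrices_def transpose_def vec_eq_iff)

lemma inverse_sym:
  assumes "K \<in> sym_matrices" "K ** \<Sigma> = mat 1"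
  shows "\<Sigma> \<in> sym_matrices"
proof -
  have "transpose \<Sigma> ** K = mat 1"
    using assms by (metis (mono_tags) matrix_transpose_mul mem_Collect_eq sym_matrices_def transpose_mat)
  then have "transpose \<Sigma> = \<Sigma>"
    using assms by (metis matrix_mul_assoc matrix_mul_lid matrix_mul_rid)
  then show ?thesis by (simp add: sym_matrices_def)
qed

lemma closed_sym_matrices: "closed (sym_matrices :: (complex^'n::finite^'n) set)"
proof -
  have "sym_matrices = (\<Inter>i j. {M :: complex^'n^'n. M $ i $ j = M $ j $ i})"
    by (auto simp: sym_matrices_iff)
  also have "closed \<dots>" by (intro closed_INT ballI closed_Collect_eq continuous_intros)
  finally show ?thesis .
qed

lemma L_inverse_sym: "L_inverse E \<subseteq> sym_matrices"
  unfolding L_inverse_def inverses_eq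
  by (rule closure_minimal) (auto simp: L_space_def closed_sym_matrices intro: inverse_sym)

section \<open>Matrices supported on the graph\<close>

definition on_graph :: "'n set set \<Rightarrow> 'n \<Rightarrow> 'n \<Rightarrow> bool" where
  "on_graph E i j \<longleftrightarrow> i = j \<or> {i, j} \<in> E"

lemma on_graph_refl [simp]: "on_graph E i i" and on_graph_commute: "on_graph E i j = on_graph E j i"
  by (auto simp: on_graph_def insert_commute)

lemma L_space_iff:
  "K \<in> L_space E \<longleftrightarrow> K \<in> sym_matrices \<and> (\<forall>i j. \<not> on_graph E i j \<longrightarrow> K $ i $ j = 0)"
  by (auto simp: L_space_def on_graph_def)

lemma line_L_space: "A \<in> L_space E \<Longrightarrow> B \<in> L_space E \<Longrightarrow> line A B t \<in> L_space E"
  by (auto simp: L_space_iff sym_matrices_iff)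

lemma line_sym: "A \<in> sym_matrices \<Longrightarrow> B \<in> sym_matrices \<Longrightarrow> line A B t \<in> sym_matrices"
  by (auto simp: sym_matrices_iff)

lemma mat_1_L_space: "mat 1 \<in> L_space E"
  by (auto simp: L_space_iff sym_matrices_iff mat_def)

lemma trace_mult_eq: "trace (A ** B) = (\<Sum>i\<in>UNIV. \<Sum>j\<in>UNIV. A $ i $ j * B $ j $ i)"
  for A B :: "complex^'n^'n"
  by (simp add: trace_def matrix_matrix_mult_def)

lemma L_perp_iff:
  "B \<in> L_perp E \<longleftrightarrow> B \<in> sym_matrices \<and> (\<forall>i j. on_graph E i j \<longrightarrow> B $ i $ j = 0)"
proof (intro iffI)
  assume B: "B \<in> L_perp E"
  then have B_sym: "B \<in> sym_matrices" by (simp add: L_perp_def)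
  have "B $ i $ j = 0" if ij: "on_graph E i j" for i j
  proof -
    from B_sym have sym: "B $ j $ i = B $ i $ j" by (simp add: sym_matrices_iff)
    \<comment> \<open>The unit matrices at (i, j) and (j, i) are added even when i = j, so by
      symmetry of \<open>B\<close> the trace is twice \<open>B $ i $ j\<close> in every
      case.\<close>
    define A :: "complex^'a^'a"
      where "A = (\<chi> k l. (if l = j then (if k = i then 1 else 0) else 0) + (if l = i then (if k = j then 1 else 0) else 0))"
    have "A \<in> L_space E" using ij
      by (auto simp: L_space_iff sym_matrices_iff A_def on_graph_commute)
    then have "trace (A ** B) = 0" using B by (simp add: L_perp_def)
    moreover have "trace (A ** B) = B $ j $ i + B $ i $ j"
      by (simp add: trace_mult_eq A_def distrib_right sum.distrib if_distrib[of "\<lambda>x. x * _"] cong: if_cong)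
    ultimately show "B $ i $ j = 0" using sym by simp
  qed
  with B_sym show "B \<in> sym_matrices \<and> (\<forall>i j. on_graph E i j \<longrightarrow> B $ i $ j = 0)" by blast
next
  assume B: "B \<in> sym_matrices \<and> (\<forall>i j. on_graph E i j \<longrightarrow> B $ i $ j = 0)"
  have "A $ i $ j * B $ j $ i = 0" if "A \<in> L_space E" for A i j
    using B that by (cases "on_graph E i j") (auto simp: L_space_iff on_graph_commute)
  then have "trace (A ** B) = 0" if "A \<in> L_space E" for A
    unfolding trace_mult_eq using that by (intro sum.neutral ballI)
  then show "B \<in> L_perp E" using B by (simp add: L_perp_def)
qed

text \<open>Adding \<open>L_perp E\<close> frees exactly the entries off the graph, so critical
  points are completions of the graph entries of \<open>S\<close> inside
  \<open>L_inverse E\<close>.\<close>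

lemma critical_points_iff:
  assumes "S \<in> sym_matrices"
  shows "\<Sigma> \<in> critical_points E S \<longleftrightarrow>
    \<Sigma> \<in> L_inverse E \<and> (\<forall>i j. on_graph E i j \<longrightarrow> \<Sigma> $ i $ j = S $ i $ j)"
proof
  assume "\<Sigma> \<in> critical_points E S"
  then show "\<Sigma> \<in> L_inverse E \<and> (\<forall>i j. on_graph E i j \<longrightarrow> \<Sigma> $ i $ j = S $ i $ j)"
    by (auto simp: critical_points_def L_perp_iff)
next
  assume *: "\<Sigma> \<in> L_inverse E \<and> (\<forall>i j. on_graph E i j \<longrightarrow> \<Sigma> $ i $ j = S $ i $ j)"
  then have "\<Sigma> \<in> sym_matrices" using L_inverse_sym by blast
  then have "\<Sigma> - S \<in> L_perp E" using * assms by (auto simp: L_perp_iff sym_matrices_iff)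
  then show "\<Sigma> \<in> critical_points E S"
    using * unfolding critical_points_def by (auto intro!: exI[of _ "\<Sigma> - S"])
qed

section \<open>Well-definedness of the ML degree\<close>

text \<open>On the line joining a witness of each genericity polynomial, both restrict to nonzero
  polynomials in one variable, and so their product has a nonroot.\<close>

lemma for_generic_sym_conj:
  assumes "for_generic_sym P" "for_generic_sym Q"
  shows "\<exists>S\<in>sym_matrices. P S \<and> Q S"
proof -
  obtain p A where p: "matrix_polynomial p" "A \<in> sym_matrices" "p A \<noteq> 0"
      "\<And>S. S \<in> sym_matrices \<Longrightarrow> p S \<noteq> 0 \<Longrightarrow> P S"
    using assms(1) by (auto simp: for_generic_sym_def)
  obtain q B where q: "matrix_polynomial q" "B \<in> sym_matrices" "q B \<noteq> 0"
      "\<And>S. S \<in> sym_matrices \<Longrightarrow> q S \<noteq> 0 \<Longrightarrow> Q S"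
    using assms(2) by (auto simp: for_generic_sym_def)
  obtain f where f: "\<And>t. p (line A B t) = poly f t" using matrix_polynomial_along_line[OF p(1), of A B] by blast
  obtain g where g: "\<And>t. q (line A B t) = poly g t" using matrix_polynomial_along_line[OF q(1), of A B] by blast
  have "f \<noteq> 0" using f[of 0] p(3) by auto
  moreover have "g \<noteq> 0" using g[of 1] q(3) by auto
  ultimately have "f * g \<noteq> 0" by simp
  then obtain t where "poly (f * g) t \<noteq> 0" using poly_all_0_iff_0 by blast
  then have "p (line A B t) \<noteq> 0" "q (line A B t) \<noteq> 0" by (auto simp: f g)
  then show ?thesis using p(2,4) q(2,4) line_sym by blast
qed

lemma ml_degree_eq_1_iff: "ml_degree E = 1 \<longleftrightarrow> has_ml_degree E 1"
proof -
  have "d = d'" if "has_ml_degree E d" "has_ml_degree E d'" for d d'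
    using for_generic_sym_conj[OF that[unfolded has_ml_degree_def]] by auto
  then have "(THE d. has_ml_degree E d) = d" if "has_ml_degree E d" for d
    using that by blast
  then show ?thesis by (auto simp: ml_degree_def)
qed

section \<open>Critical points near the identity\<close>

lemma tendsto_det:
  fixes K :: "'a \<Rightarrow> complex^'n^'n"
  assumes "(K \<longlongrightarrow> K0) F"
  shows "((\<lambda>x. det (K x)) \<longlongrightarrow> det K0) F"
  unfolding det_def by (intro tendsto_intros assms)

lemma tendsto_line: "(line A B \<longlongrightarrow> A) (at 0)"
proof -
  have "(line A B \<longlongrightarrow> line A B 0) (at 0)"
    using continuous_line[of A B] by (simp add: continuous_on_def del: line_0)
  then show ?thesis by simp
qed

lemma tendsto_right_inverse:
  fixes K \<Sigma> :: "'a \<Rightarrow> complex^'n^'n"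
  assumes K: "(K \<longlongrightarrow> K0) F" and inv0: "K0 ** \<Sigma>0 = mat 1"
    and inv: "eventually (\<lambda>x. K x ** \<Sigma> x = mat 1) F"
  shows "(\<Sigma> \<longlongrightarrow> \<Sigma>0) F"
proof (intro vec_tendstoI)
  fix k l
  have nz: "det A \<noteq> 0" if "A ** B = mat 1" for A B :: "complex^'n^'n"
    using that invertible_det_nz invertible_right_inverse by blast
  define C where "C A = (\<chi> i j. if j = k then (if i = l then 1 else 0) else A $ i $ j)" for A :: "complex^'n^'n"
  have C: "B $ k $ l = det (C A) / det A" if "A ** B = mat 1" for A B
    using cramer_right_inverse[OF that, of k l] nz[OF that] by (simp add: C_def field_simps)
  have "((\<lambda>x. C (K x)) \<longlongrightarrow> C K0) F"
  proof (intro vec_tendstoI)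
    fix i j
    show "((\<lambda>x. C (K x) $ i $ j) \<longlongrightarrow> C K0 $ i $ j) F"
      using tendsto_vec_nth[OF tendsto_vec_nth[OF K], of i j] by (simp add: C_def)
  qed
  then have "((\<lambda>x. det (C (K x)) / det (K x)) \<longlongrightarrow> det (C K0) / det K0) F"
    using nz[OF inv0] by (intro tendsto_divide tendsto_det K)
  moreover have "eventually (\<lambda>x. det (C (K x)) / det (K x) = \<Sigma> x $ k $ l) F"
    using inv by eventually_elim (simp add: C)
  ultimately show "((\<lambda>x. \<Sigma> x $ k $ l) \<longlongrightarrow> \<Sigma>0 $ k $ l) F"
    unfolding C[OF inv0] by (rule Lim_transform_eventually)
qed

text \<open>Symmetrizing makes this a projection of the space of all matrices onto
  \<open>L_space E\<close>; the open mapping argument below runs on that whole space.\<close>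

definition L_proj :: "'n set set \<Rightarrow> complex^'n^'n \<Rightarrow> complex^'n^'n" where
  "L_proj E M = (\<chi> i j. if on_graph E i j then (M $ i $ j + M $ j $ i) / 2 else 0)"

lemma L_proj_nth: "L_proj E M $ i $ j = (if on_graph E i j then (M $ i $ j + M $ j $ i) / 2 else 0)"
  by (simp add: L_proj_def)

lemma L_proj_L_space: "L_proj E M \<in> L_space E"
  by (auto simp: L_space_iff sym_matrices_iff L_proj_nth on_graph_commute)

lemma L_proj_ident: "M \<in> L_space E \<Longrightarrow> L_proj E M = M"
  by (auto simp: L_space_iff sym_matrices_iff L_proj_nth vec_eq_iff)

lemma L_proj_sym: "M \<in> sym_matrices \<Longrightarrow> on_graph E i j \<Longrightarrow> L_proj E M $ i $ j = M $ i $ j"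
  by (auto simp: sym_matrices_iff L_proj_nth)

lemma L_proj_idem: "L_proj E (L_proj E M) = L_proj E M"
  by (simp add: L_proj_ident L_proj_L_space)

lemma bounded_linear_L_proj: "bounded_linear (L_proj E :: complex^'n::finite^'n \<Rightarrow> _)"
  unfolding linear_conv_bounded_linear[symmetric]
  by (rule linearI) (simp_all add: vec_eq_iff L_proj_nth scaleR_conv_of_real[where 'a = complex] distrib_left add_divide_distrib)

lemma bounded_bilinear_matrix_mult:
  "bounded_bilinear (\<lambda>A B :: complex^'n::finite^'n. A ** B)"
  unfolding bilinear_conv_bounded_bilinear[symmetric] bilinear_def
  by (auto intro!: linearI simp: vec_eq_iff matrix_matrix_mult_def algebra_simps sum.distrib scaleR_sum_right)

text \<open>The pair map below is polynomial and has an invertible derivative at the pair of identity matrices; its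
  second component forces the first matrix into the space of the graph.\<close>
lemma local_completion:
  fixes E :: "'n::finite set set"
  assumes "\<delta> > 0"
  obtains \<epsilon> where "\<epsilon> > 0"
    "\<And>Y. Y \<in> L_space E \<Longrightarrow> dist Y (mat 1) < \<epsilon> \<Longrightarrow>
      \<exists>K\<in>L_space E. \<exists>\<Sigma>. K ** \<Sigma> = mat 1 \<and> dist \<Sigma> (mat 1) < \<delta> \<and>
        (\<forall>i j. on_graph E i j \<longrightarrow> \<Sigma> $ i $ j = Y $ i $ j)"
proof -
  let ?R = "L_proj E :: complex^'n^'n \<Rightarrow> _"
  let ?I = "mat 1 :: complex^'n^'n"
  interpret R: bounded_linear ?R by (rule bounded_linear_L_proj)
  interpret mm: bounded_bilinear "\<lambda>A B :: complex^'n^'n. A ** B" by (rule bounded_bilinear_matrix_mult)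
  define F where "F = (\<lambda>P. (fst P ** snd P, ?R (snd P) + fst P - ?R (fst P)))"
  define F' where "F' = (\<lambda>P. (fst P + snd P, ?R (snd P) + fst P - ?R (fst P)))"
  \<comment> \<open>A right inverse of \<open>F'\<close>. With R for the projection,
    \<open>F'\<close> sends (H, a - H) to (a, R a + (1 - 2 R) H), and 1 - 2 R is its own inverse
    because R is idempotent; hence H = (1 - 2 R) (b - R a). The open mapping theorem asks for a
    right inverse only.\<close>
  define G where "G = (\<lambda>P. let C = snd P - ?R (fst P); H = C - ?R C - ?R C in (H, fst P - H))"
  have "(F has_derivative F') (at (?I, ?I))"
  proof -
    have 1: "(fst has_derivative fst) (at (?I, ?I))" and 2: "(snd has_derivative snd) (at (?I, ?I))"
      by (intro bounded_linear_imp_has_derivative bounded_linear_fst bounded_linear_snd)+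
    have "((\<lambda>P. fst P ** snd P) has_derivative (\<lambda>H. fst (?I, ?I) ** snd H + fst H ** snd (?I, ?I))) (at (?I, ?I))"
      by (rule mm.FDERIV[OF 1 2])
    moreover have "((\<lambda>P. ?R (snd P) + fst P - ?R (fst P)) has_derivative (\<lambda>H. ?R (snd H) + fst H - ?R (fst H))) (at (?I, ?I))"
      by (intro has_derivative_diff has_derivative_add R.has_derivative 1 2)
    ultimately have "(F has_derivative (\<lambda>H. (fst (?I, ?I) ** snd H + fst H ** snd (?I, ?I), ?R (snd H) + fst H - ?R (fst H)))) (at (?I, ?I))"
      unfolding F_def by (rule has_derivative_Pair)
    then show ?thesis by (simp add: F'_def add.commute)
  qed
  moreover have "bounded_linear G"
    unfolding G_def Let_def
    by (intro bounded_linear_Pair bounded_linear_sub bounded_linear_compose[OF R.bounded_linear]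
        bounded_linear_fst bounded_linear_snd)
  moreover have "F' \<circ> G = id"
  proof (rule ext, clarify)
    fix a b
    define C where "C = b - ?R a"
    define H where "H = C - ?R C - ?R C"
    have RH: "?R H = - ?R C" unfolding H_def R.diff L_proj_idem by simp
    have "?R (a - H) + H - ?R H = ?R a + C" unfolding R.diff RH by (simp add: H_def)
    then have "?R (a - H) + H - ?R H = b" by (simp add: C_def)
    moreover have "G (a, b) = (H, a - H)" by (simp add: G_def Let_def H_def C_def)
    ultimately show "(F' \<circ> G) (a, b) = id (a, b)" by (simp add: F'_def)
  qed
  moreover have "continuous_on UNIV F"
    unfolding F_def by (intro continuous_intros mm.continuous_on R.continuous_on)
  ultimately have "F (?I, ?I) \<in> interior (F ` ball (?I, ?I) \<delta>)"
    using assms by (intro sussmann_open_mapping[where S = UNIV]) auto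
  moreover have "F (?I, ?I) = (?I, ?I)" by (simp add: F_def)
  ultimately obtain \<epsilon> where \<epsilon>: "\<epsilon> > 0" "ball (?I, ?I) \<epsilon> \<subseteq> F ` ball (?I, ?I) \<delta>"
    by (auto simp: mem_interior)
  show thesis
  proof (rule that[OF \<epsilon>(1)])
    fix Y assume Y: "Y \<in> L_space E" "dist Y ?I < \<epsilon>"
    then have "(?I, Y) \<in> ball (?I, ?I) \<epsilon>" by (simp add: dist_Pair_Pair dist_commute)
    then obtain K \<Sigma> where K\<Sigma>: "(K, \<Sigma>) \<in> ball (?I, ?I) \<delta>" "F (K, \<Sigma>) = (?I, Y)"
      using \<epsilon>(2) by (metis (no_types, lifting) imageE subsetD surj_pair)
    then have 1: "K ** \<Sigma> = ?I" and 2: "?R \<Sigma> + K - ?R K = Y" by (auto simp: F_def)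
    have "?R Y = ?R \<Sigma>" by (simp add: R.diff R.add L_proj_idem flip: 2)
    then have "?R \<Sigma> = Y" using Y by (simp add: L_proj_ident)
    then have "K = ?R K" using 2 by simp
    then have K: "K \<in> L_space E" by (metis L_proj_L_space)
    then have "\<Sigma> \<in> sym_matrices" using inverse_sym[OF _ 1] by (simp add: L_space_def)
    then have "\<forall>i j. on_graph E i j \<longrightarrow> \<Sigma> $ i $ j = Y $ i $ j"
      using L_proj_sym \<open>?R \<Sigma> = Y\<close> by metis
    moreover have "dist \<Sigma> ?I < \<delta>"
      using K\<Sigma>(1) dist_snd_le[of "(K, \<Sigma>)" "(?I, ?I)"] by (simp add: dist_commute)
    ultimately show "\<exists>K\<in>L_space E. \<exists>\<Sigma>. K ** \<Sigma> = mat 1 \<and> dist \<Sigma> (mat 1) < \<delta> \<and>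
        (\<forall>i j. on_graph E i j \<longrightarrow> \<Sigma> $ i $ j = Y $ i $ j)"
      using K 1 by blast
  qed
qed

section \<open>Two critical points of one generic matrix\<close>

lemma L_inverseI: "K \<in> L_space E \<Longrightarrow> K ** \<Sigma> = mat 1 \<Longrightarrow> \<Sigma> \<in> L_inverse E"
  unfolding L_inverse_def inverses_eq by (rule subsetD[OF closure_subset]) auto

text \<open>Neither \<open>\<Sigma>0\<close> nor the identity need be generic, and
  \<open>\<Sigma>0\<close> may be a mere limit of inverses. The aim is a generic matrix with one
  critical point close to \<open>\<Sigma>0\<close> and another close to the identity.\<close>

lemma second_critical_point_not_ml_degree_1:
  fixes E :: "'n::finite set set"
  assumes "\<Sigma>0 \<in> L_inverse E" "\<Sigma>0 \<noteq> mat 1"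
    and "\<And>i j. on_graph E i j \<Longrightarrow> \<Sigma>0 $ i $ j = mat 1 $ i $ j"
  shows "\<not> has_ml_degree E 1"
proof
  let ?R = "L_proj E :: complex^'n^'n \<Rightarrow> _"
  let ?I = "mat 1 :: complex^'n^'n"
  assume "has_ml_degree E 1"
  then obtain p where p': "matrix_polynomial p \<and> (\<exists>S\<in>sym_matrices. p S \<noteq> 0) \<and>
      (\<forall>S\<in>sym_matrices. p S \<noteq> 0 \<longrightarrow> finite (critical_points E S) \<and> card (critical_points E S) = 1)"
    unfolding has_ml_degree_def for_generic_sym_def ..
  then have one: "\<And>S. S \<in> sym_matrices \<Longrightarrow> p S \<noteq> 0 \<Longrightarrow> card (critical_points E S) = 1"
    by simp
  from p' obtain S1 where p: "matrix_polynomial p" "S1 \<in> sym_matrices" "p S1 \<noteq> 0"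
    by (elim conjE bexE)
  \<comment> \<open>Half the distance keeps the two balls of radius \<open>\<delta>\<close>
    disjoint.\<close>
  define \<delta> where "\<delta> = dist \<Sigma>0 ?I / 2"
  have "\<delta> > 0" using assms(2) by (simp add: \<delta>_def)
  then obtain \<epsilon> where "\<epsilon> > 0" and
    \<epsilon>: "\<And>Y. Y \<in> L_space E \<Longrightarrow> dist Y ?I < \<epsilon> \<Longrightarrow>
      \<exists>K\<in>L_space E. \<exists>\<Sigma>. K ** \<Sigma> = mat 1 \<and> dist \<Sigma> ?I < \<delta> \<and>
        (\<forall>i j. on_graph E i j \<longrightarrow> \<Sigma> $ i $ j = Y $ i $ j)"
    by (rule local_completion[of \<delta> E]) blast
  have contR: "continuous_on UNIV ?R"
    by (rule linear_continuous_on[OF bounded_linear_L_proj])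
  have symm: "\<Sigma>0 \<in> sym_matrices" using assms(1) L_inverse_sym by blast
  have "?R \<Sigma>0 = ?I"
  proof (intro iffD2[OF vec_eq_iff] allI)
    fix i j
    show "?R \<Sigma>0 $ i $ j = ?I $ i $ j"
      using assms(3) L_proj_sym[OF symm]
      by (cases "on_graph E i j") (auto simp: L_proj_nth mat_def)
  qed
  \<comment> \<open>Close to \<open>\<Sigma>0\<close>, and with graph entries so close to those of
    the identity that they also have a completion near the identity.\<close>
  define U where "U = {\<Sigma>. dist \<Sigma> \<Sigma>0 < \<delta>} \<inter> {\<Sigma>. dist (?R \<Sigma>) ?I < \<epsilon>}"
  have "open U"
    unfolding U_def by (intro open_Int open_Collect_less continuous_intros contR)
  have "\<Sigma>0 \<in> U" using \<open>\<delta> > 0\<close> \<open>\<epsilon> > 0\<close> \<open>?R \<Sigma>0 = ?I\<close> by (simp add: U_def)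
  then obtain K2 \<Sigma>2 where K2: "K2 \<in> L_space E" "K2 ** \<Sigma>2 = mat 1" "\<Sigma>2 \<in> U"
    using assms(1) \<open>open U\<close> unfolding L_inverse_def inverses_eq closure_iff_nhds_not_empty
    by blast
  obtain f where f: "\<And>t. p (line ?I S1 t) = poly f t"
    using matrix_polynomial_along_line[OF p(1), of ?I S1] by blast
  have "f \<noteq> 0" using f[of 1] p(3) by auto
  have "((\<lambda>t. ?R (line ?I S1 t)) \<longlongrightarrow> ?R ?I) (at 0)"
    by (intro bounded_linear.tendsto[OF bounded_linear_L_proj] tendsto_line)
  then have "eventually (\<lambda>t. dist (?R (line ?I S1 t)) ?I < \<epsilon>) (at 0)"
    using \<open>\<epsilon> > 0\<close> by (simp add: L_proj_ident mat_1_L_space tendstoD)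
  with poly_frequently_nonzero[OF \<open>f \<noteq> 0\<close>, of 0]
  have "eventually (\<lambda>t. poly f t \<noteq> 0 \<and> dist (?R (line ?I S1 t)) ?I < \<epsilon>) (at 0)"
    by eventually_elim simp
  then obtain t where t: "poly f t \<noteq> 0" "dist (?R (line ?I S1 t)) ?I < \<epsilon>"
    using eventually_happens'[OF at_neq_bot] by blast
  define S where "S = line ?I S1 t"
  have S: "S \<in> sym_matrices" "p S \<noteq> 0"
    using t(1) p(2) mat_1_L_space by (auto simp: S_def f L_space_def intro!: line_sym)
  obtain K' \<Sigma>' where K': "K' \<in> L_space E" "K' ** \<Sigma>' = mat 1"
      "\<forall>i j. on_graph E i j \<longrightarrow> \<Sigma>' $ i $ j = ?R S $ i $ j"
    using \<epsilon>[OF L_proj_L_space t(2)] unfolding S_def by blast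
  \<comment> \<open>\<open>C\<close> vanishes on the graph and \<open>\<Sigma>' + C\<close> is the
    generic matrix \<open>S\<close>. Along the line from \<open>K2\<close> to \<open>K'\<close>,
    \<open>p\<close> of the inverse plus \<open>C\<close> is thus nonzero at t = 1, hence also for
    suitable small t, where the inverse is still in \<open>U\<close>.\<close>
  define C where "C = S - \<Sigma>'"
  have "\<Sigma>' \<in> sym_matrices" using K' inverse_sym by (auto simp: L_space_def)
  then have C: "C \<in> sym_matrices" "\<And>i j. on_graph E i j \<Longrightarrow> C $ i $ j = 0"
    using S K'(3) L_proj_sym[OF S(1)] by (auto simp: C_def sym_matrices_iff)
  obtain d N q where d: "d \<noteq> 0" "\<And>t. det (line K2 K' t) = poly d t"
    and q: "\<And>t \<Sigma>. line K2 K' t ** \<Sigma> = mat 1 \<Longrightarrow> p (\<Sigma> + C) * poly d t ^ N = poly q t"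
    using matrix_polynomial_inverse_line[OF p(1) K2(2), of K' C] by blast
  have "poly d 1 \<noteq> 0"
    using d(2)[of 1] K'(2) by (metis invertible_det_nz invertible_right_inverse line_1)
  then have "q \<noteq> 0" using q[of 1 \<Sigma>'] K'(2) S(2) by (auto simp: C_def)
  define \<Sigma> where "\<Sigma> t = matrix_inv (line K2 K' t)" for t
  have dnz: "eventually (\<lambda>t. poly d t \<noteq> 0) (at 0)" and qnz: "eventually (\<lambda>t. poly q t \<noteq> 0) (at 0)"
    by (rule poly_frequently_nonzero; fact)+
  have inv: "eventually (\<lambda>t. line K2 K' t ** \<Sigma> t = mat 1) (at 0)"
    using dnz by eventually_elim (auto simp: \<Sigma>_def invertible_det_nz d(2) intro!: matrix_inv_inverse)
  have "(\<Sigma> \<longlongrightarrow> \<Sigma>2) (at 0)"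
    by (rule tendsto_right_inverse[OF tendsto_line K2(2) inv])
  then have "eventually (\<lambda>t. \<Sigma> t \<in> U) (at 0)"
    using \<open>open U\<close> K2(3) by (rule topological_tendstoD)
  with inv qnz have "eventually (\<lambda>t. line K2 K' t ** \<Sigma> t = mat 1 \<and> poly q t \<noteq> 0 \<and> \<Sigma> t \<in> U) (at 0)"
    by eventually_elim simp
  then obtain t where t: "line K2 K' t ** \<Sigma> t = mat 1" "poly q t \<noteq> 0" "\<Sigma> t \<in> U"
    using eventually_happens'[OF at_neq_bot] by blast
  have line: "line K2 K' t \<in> L_space E" by (intro line_L_space K2 K')
  then have sym: "\<Sigma> t \<in> sym_matrices" using inverse_sym t(1) by (auto simp: L_space_def)
  then have T: "\<Sigma> t + C \<in> sym_matrices" using C(1) by (auto simp: sym_matrices_iff)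
  have "p (\<Sigma> t + C) \<noteq> 0" using q[OF t(1)] t(2) by auto
  then have "card (critical_points E (\<Sigma> t + C)) = 1" using one T by blast
  moreover have "\<Sigma> t \<in> critical_points E (\<Sigma> t + C)"
    using L_inverseI[OF line t(1)] C(2) by (auto simp: critical_points_iff[OF T])
  moreover obtain K4 \<Sigma>4 where K4: "K4 \<in> L_space E" "K4 ** \<Sigma>4 = mat 1" "dist \<Sigma>4 ?I < \<delta>"
      "\<forall>i j. on_graph E i j \<longrightarrow> \<Sigma>4 $ i $ j = ?R (\<Sigma> t) $ i $ j"
    using \<epsilon>[OF L_proj_L_space, of "\<Sigma> t"] t(3) by (auto simp: U_def)
  moreover have "\<Sigma>4 \<in> critical_points E (\<Sigma> t + C)"
    using L_inverseI[OF K4(1,2)] K4(4) C(2) L_proj_sym[OF sym]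
    by (auto simp: critical_points_iff[OF T])
  ultimately have "\<Sigma>4 = \<Sigma> t" by (auto simp: card_1_singleton_iff)
  then have "dist (\<Sigma> t) ?I < \<delta>" "dist (\<Sigma> t) \<Sigma>0 < \<delta>" using K4(3) t(3) by (auto simp: U_def)
  then have "dist \<Sigma>0 ?I < \<delta> + \<delta>" using dist_triangle2[of \<Sigma>0 ?I "\<Sigma> t"] dist_triangle3[of \<Sigma>0 ?I "\<Sigma> t"] by linarith
  then show False by (simp add: \<delta>_def)
qed

section \<open>Chordless cycles\<close>

text \<open>The residue of a - b modulo m, arranged so that natural subtraction does not truncate
  for b at most m.\<close>

definition gap :: "nat \<Rightarrow> nat \<Rightarrow> nat \<Rightarrow> nat" where
  "gap m a b = (a + (m - b)) mod m"

lemma gap_eq: "a < m \<Longrightarrow> b < m \<Longrightarrow> gap m a b = (if b \<le> a then a - b else a + m - b)"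
  by (auto simp: gap_def mod_if)

lemma gap_less: "0 < m \<Longrightarrow> gap m a b < m"
  by (simp add: gap_def)

lemma gap_Suc: "gap m (Suc a mod m) b = Suc (gap m a b) mod m"
  unfolding gap_def by (simp add: mod_simps)

lemma gap_pred: "gap m ((a + (m - 1)) mod m) b = (gap m a b + (m - 1)) mod m"
  unfolding gap_def by (simp add: mod_simps ac_simps)

text \<open>An unnormalized geometric correlation at distance e, running both ways around a cycle of
  length m.\<close>

definition cycle_fun :: "nat \<Rightarrow> complex \<Rightarrow> nat \<Rightarrow> complex" where
  "cycle_fun m r e = r ^ e + r ^ (m - e)"

lemma cycle_fun_gap_commute:
  assumes "a < m" "b < m"
  shows "cycle_fun m r (gap m a b) = cycle_fun m r (gap m b a)"
proof (cases a b rule: linorder_cases)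
  case less
  then have "gap m a b = m - (b - a)" "gap m b a = b - a" "b - a \<le> m"
    using assms by (auto simp: gap_eq)
  then show ?thesis by (simp add: cycle_fun_def)
next
  case greater
  then have "gap m b a = m - (a - b)" "gap m a b = a - b" "a - b \<le> m"
    using assms by (auto simp: gap_eq)
  then show ?thesis by (simp add: cycle_fun_def)
qed simp

text \<open>Both summands solve the three-term recurrence with characteristic roots \<^term>\<open>r\<close> and \<^term>\<open>1 / r\<close>, so it
  only fails at \<^term>\<open>e = 0\<close>.\<close>
lemma cycle_fun_recurrence:
  assumes "e < m" "2 \<le> m"
  shows "(1 + r\<^sup>2) * cycle_fun m r e - r * cycle_fun m r (Suc e mod m) - r * cycle_fun m r ((e + (m - 1)) mod m)
    = (if e = 0 then (1 - r\<^sup>2) * (1 - r ^ m) else 0)"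
proof (cases e)
  case 0
  obtain k where "m = Suc (Suc k)" using assms by (metis add_2_eq_Suc le_Suc_ex)
  then show ?thesis using 0 by (simp add: cycle_fun_def algebra_simps power2_eq_square)
next
  case (Suc e')
  obtain k where k: "m = Suc (e + k)" using assms less_iff_Suc_add by blast
  have "cycle_fun m r (Suc e mod m) = r ^ Suc e + r ^ k"
    using k by (cases "k = 0") (auto simp: cycle_fun_def)
  moreover have "(e + (m - 1)) mod m = e'"
    using k Suc by (simp add: mod_if)
  then have "cycle_fun m r ((e + (m - 1)) mod m) = r ^ e' + r ^ (k + 2)"
    using k Suc by (simp add: cycle_fun_def)
  moreover have "cycle_fun m r e = r ^ Suc e' + r ^ Suc k"
    using k Suc by (simp add: cycle_fun_def Suc_diff_le)
  ultimately show ?thesis using Suc by (simp add: algebra_simps power2_eq_square)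
qed

text \<open>By the recurrence, the inverse of a circulant built from \<open>cycle_fun\<close> is
  supported on the diagonal and the cycle edges, so it lies in \<open>L_space E\<close>. Without
  chords, an edge of the graph between cycle vertices joins consecutive ones, and there the limit
  vanishes.\<close>

lemma chordless_cycle_critical_point:
  fixes E :: "'n::finite set set"
  assumes cyc: "cycle_in E vs" and len: "length vs \<ge> 4" and chord: "\<not> has_chord E vs"
  obtains \<Sigma>0 where "\<Sigma>0 \<in> L_inverse E" "\<Sigma>0 \<noteq> mat 1"
    "\<And>i j. on_graph E i j \<Longrightarrow> \<Sigma>0 $ i $ j = mat 1 $ i $ j"
proof -
  define m where "m = length vs"
  have m: "m \<ge> 4" and dist: "distinct vs" and sub: "cycle_edges vs \<subseteq> E"
    using cyc len by (auto simp: m_def cycle_in_def)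
  have edges: "cycle_edges vs = {{vs ! a, vs ! (Suc a mod m)} | a. a < m}"
    by (simp add: cycle_edges_def m_def)
  define idx where "idx i = (SOME a. a < m \<and> vs ! a = i)" for i
  have idx: "idx i < m" "vs ! idx i = i" if "i \<in> set vs" for i
    using someI_ex[of "\<lambda>a. a < m \<and> vs ! a = i"] that by (auto simp: idx_def m_def in_set_conv_nth)
  have nth_set: "vs ! a \<in> set vs" if "a < m" for a using that by (simp add: m_def)
  have idx_nth: "idx (vs ! a) = a" if "a < m" for a
    using idx[OF nth_set[OF that]] that dist by (simp add: nth_eq_iff_index_eq m_def)
  define nx where "nx i = vs ! (Suc (idx i) mod m)" for i
  define pv where "pv i = vs ! ((idx i + (m - 1)) mod m)" for i
  have m0: "0 < m" using m by simp
  have nx: "nx i \<in> set vs" "idx (nx i) = Suc (idx i) mod m" for i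
    using m0 by (auto simp: nx_def idx_nth intro!: nth_set)
  have pv: "pv i \<in> set vs" "idx (pv i) = (idx i + (m - 1)) mod m" for i
    using m0 by (auto simp: pv_def idx_nth intro!: nth_set)
  have nx_pv: "nx (pv i) = i" "pv (nx i) = i" if "i \<in> set vs" for i
  proof -
    have "(Suc a mod m + (m - 1)) mod m = a" "Suc ((a + (m - 1)) mod m) mod m = a" if "a < m" for a
    proof -
      have "(Suc a mod m + (m - 1)) mod m = (Suc a + (m - 1)) mod m" by (rule mod_add_left_eq)
      also have "Suc a + (m - 1) = a + m" using m0 by simp
      finally show "(Suc a mod m + (m - 1)) mod m = a" using that by simp
      have "Suc ((a + (m - 1)) mod m) mod m = Suc (a + (m - 1)) mod m" by (rule mod_Suc_eq)
      also have "Suc (a + (m - 1)) = a + m" using m0 by simp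
      finally show "Suc ((a + (m - 1)) mod m) mod m = a" using that by simp
    qed
    then show "nx (pv i) = i" "pv (nx i) = i"
      using idx[OF that] m0 by (simp_all add: nx_def pv_def idx_nth)
  qed
  have nx_edge: "{i, nx i} \<in> E" if "i \<in> set vs" for i
  proof -
    have "{vs ! idx i, vs ! (Suc (idx i) mod m)} \<in> cycle_edges vs"
      unfolding edges using idx(1)[OF that] by (intro CollectI exI[of _ "idx i"]) simp
    then show ?thesis using sub idx(2)[OF that] by (auto simp: nx_def)
  qed
  have pv_edge: "{i, pv i} \<in> E" if "i \<in> set vs" for i
    using nx_edge[OF pv(1)[of i]] nx_pv(1)[OF that] by (simp add: insert_commute)
  \<comment> \<open>A root of r ^ (m - 2) = -1. As m is at least 4, its angle is at most pi / 2, so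
    it is not real and its square differs from 1.\<close>
  define r0 where "r0 = cis (pi / real (m - 2))"
  have r0_pow: "r0 ^ (m - 2) = -1"
  proof -
    have "real (m - 2) * (pi / real (m - 2)) = pi" using m by simp
    then show ?thesis by (simp only: r0_def Complex.DeMoivre cis_pi)
  qed
  have "Im r0 > 0"
    unfolding r0_def cis.simps using m pi_gt_zero by (intro sin_gt_zero) (simp_all add: divide_less_eq)
  then have "r0\<^sup>2 \<noteq> 1" by (auto simp: power2_eq_1_iff)
  \<comment> \<open>The value 1 + r0 ^ m of \<open>cycle_fun\<close> at distance 0, used to
    normalize the diagonal of the limit to 1. It stays fixed while r varies.\<close>
  define w where "w = 1 - r0\<^sup>2"
  have w: "w \<noteq> 0" using \<open>r0\<^sup>2 \<noteq> 1\<close> by (simp add: w_def)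
  have m2: "m = Suc (Suc (m - 2))" "m - 1 = Suc (m - 2)" using m by simp_all
  have r0_m: "r0 ^ m = - r0\<^sup>2"
    using arg_cong[OF m2(1), of "\<lambda>k. r0 ^ k"] by (simp only: power_Suc r0_pow) (simp add: power2_eq_square)
  have r0_1: "r0 ^ (m - 1) = - r0"
    by (simp only: m2(2) power_Suc r0_pow) simp
  define \<Sigma> where "\<Sigma> r = (\<chi> i j. if i \<in> set vs \<and> j \<in> set vs then cycle_fun m r (gap m (idx i) (idx j)) / w
      else if i = j then 1 else 0)" for r
  \<comment> \<open>The factor \<open>\<kappa>\<close> cancels the defect of the recurrence at
    distance 0. Adding the three contributions of a row, instead of nesting cases, lets the row sums
    split without comparing i, \<open>nx i\<close> and \<open>pv i\<close>.\<close>
  define K where "K r = (\<chi> i j. let \<kappa> = w / ((1 - r\<^sup>2) * (1 - r ^ m)) in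
      if i \<in> set vs then (if j = i then \<kappa> * (1 + r\<^sup>2) else 0) + (if j = nx i then - \<kappa> * r else 0)
        + (if j = pv i then - \<kappa> * r else 0)
      else if j = i then 1 else 0)" for r
  have inv: "K r ** \<Sigma> r = mat 1" if r: "r\<^sup>2 \<noteq> 1" "r ^ m \<noteq> 1" for r
  proof -
    define \<kappa> where "\<kappa> = w / ((1 - r\<^sup>2) * (1 - r ^ m))"
    have \<kappa>: "\<kappa> * ((1 - r\<^sup>2) * (1 - r ^ m)) = w" using r by (simp add: \<kappa>_def)
    have "(K r ** \<Sigma> r) $ i $ j = (if i = j then 1 else 0)" for i j
    proof (cases "i \<in> set vs")
      case False
      then have "(K r ** \<Sigma> r) $ i $ j = \<Sigma> r $ i $ j"
        by (simp add: matrix_matrix_mult_def K_def if_distrib[of "\<lambda>x. x * _"] cong: if_cong)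
      then show ?thesis using False by (simp add: \<Sigma>_def)
    next
      case True
      have "(K r ** \<Sigma> r) $ i $ j = (\<Sum>l\<in>UNIV. (if l = i then \<kappa> * (1 + r\<^sup>2) * \<Sigma> r $ l $ j else 0)
          + (if l = nx i then - \<kappa> * r * \<Sigma> r $ l $ j else 0) + (if l = pv i then - \<kappa> * r * \<Sigma> r $ l $ j else 0))"
        using True unfolding matrix_matrix_mult_def
        by (auto simp: K_def Let_def simp flip: \<kappa>_def intro!: sum.cong)
           (auto simp: algebra_simps)
      also have "\<dots> = \<kappa> * ((1 + r\<^sup>2) * \<Sigma> r $ i $ j - r * \<Sigma> r $ nx i $ j - r * \<Sigma> r $ pv i $ j)"
        by (simp add: sum.distrib algebra_simps)
      also have "\<dots> = (if i = j then 1 else 0)"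
      proof (cases "j \<in> set vs")
        case False
        then show ?thesis using True nx(1)[of i] pv(1)[of i] by (auto simp: \<Sigma>_def)
      next
        case j: True
        let ?e = "gap m (idx i) (idx j)"
        have e: "?e < m" using m0 by (rule gap_less)
        have "?e = 0 \<longleftrightarrow> idx i = idx j" using idx(1)[OF True] idx(1)[OF j] by (auto simp: gap_eq)
        also have "\<dots> \<longleftrightarrow> i = j" using idx(2)[OF True] idx(2)[OF j] by metis
        finally have e0: "?e = 0 \<longleftrightarrow> i = j" .
        have "\<kappa> * ((1 + r\<^sup>2) * \<Sigma> r $ i $ j - r * \<Sigma> r $ nx i $ j - r * \<Sigma> r $ pv i $ j)
          = \<kappa> * ((1 + r\<^sup>2) * cycle_fun m r ?e - r * cycle_fun m r (Suc ?e mod m)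
              - r * cycle_fun m r ((?e + (m - 1)) mod m)) / w"
          using True j nx[of i] pv[of i]
          by (simp add: \<Sigma>_def gap_Suc gap_pred[unfolded One_nat_def])
             (simp add: w field_simps)
        also have "\<dots> = (if i = j then 1 else 0)"
          using cycle_fun_recurrence[OF e, of r] m e0 \<kappa> w by simp
        finally show ?thesis .
      qed
      finally show ?thesis .
    qed
    then show ?thesis by (simp add: vec_eq_iff mat_def)
  qed
  have KL: "K r \<in> L_space E" for r
    unfolding L_space_iff sym_matrices_iff
  proof (intro conjI allI impI)
    fix i j
    show "K r $ i $ j = K r $ j $ i"
    proof (cases "i = j")
      case False
      note set = nx(1)[of i] nx(1)[of j] pv(1)[of i] pv(1)[of j]
      show ?thesis
      proof (cases "i \<in> set vs \<and> j \<in> set vs")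
        case True
        then have "i = pv j \<longleftrightarrow> j = nx i" "i = nx j \<longleftrightarrow> j = pv i"
          using nx_pv by metis+
        then show ?thesis using True False by (simp add: K_def Let_def)
      next
        case notboth: False
        then have "j \<noteq> nx i \<and> j \<noteq> pv i" if "i \<in> set vs" using set that by metis
        moreover have "i \<noteq> nx j \<and> i \<noteq> pv j" if "j \<in> set vs" using set that notboth by metis
        ultimately show ?thesis using False by (simp add: K_def Let_def)
      qed
    qed simp
  next
    fix i j assume "\<not> on_graph E i j"
    then show "K r $ i $ j = 0"
      using nx_edge[of i] pv_edge[of i] by (auto simp: K_def Let_def on_graph_def)
  qed
  \<comment> \<open>Off the unit circle both 1 - r ^ 2 and 1 - r ^ m are nonzero. At
    \<open>r0\<close> itself the second factor is 1 + r0 ^ 2, which vanishes for m = 4.\<close>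
  define r where "r n = r0 * of_real (1 + inverse (real (Suc n)))" for n
  have "norm (r n) > 1" for n
  proof -
    have "norm (r n) = 1 + inverse (real (Suc n))"
      unfolding r_def norm_mult norm_of_real by (simp add: r0_def)
    then show ?thesis by simp
  qed
  then have "norm (r n ^ k) > 1" if "k > 0" for n k
    using that by (simp add: norm_power one_less_power)
  then have r_pow: "r n ^ k \<noteq> 1" if "k > 0" for n k
    using that by (metis norm_one order_less_irrefl)
  have seq: "\<Sigma> (r n) \<in> {\<Sigma>. \<exists>K\<in>L_space E. K ** \<Sigma> = mat 1}" for n
    using inv[of "r n"] r_pow m0 KL by auto
  have lim: "(\<lambda>n. \<Sigma> (r n)) \<longlonglongrightarrow> \<Sigma> r0"
  proof (intro vec_tendstoI)
    fix i j
    have "(\<lambda>n. complex_of_real (1 + inverse (real (Suc n)))) \<longlonglongrightarrow> of_real (1 + 0)"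
      by (intro tendsto_intros LIMSEQ_inverse_real_of_nat)
    then have "r \<longlonglongrightarrow> r0 * of_real (1 + 0)"
      unfolding r_def by (intro tendsto_mult tendsto_const)
    then have "r \<longlonglongrightarrow> r0" by simp
    then show "(\<lambda>n. \<Sigma> (r n) $ i $ j) \<longlonglongrightarrow> \<Sigma> r0 $ i $ j"
      by (auto simp: \<Sigma>_def cycle_fun_def intro!: tendsto_intros w)
  qed
  have 1: "\<Sigma> r0 \<in> L_inverse E"
    unfolding L_inverse_def inverses_eq closure_sequential
    by (intro exI[of _ "\<lambda>n. \<Sigma> (r n)"] conjI allI seq lim)
  have G0: "cycle_fun m r0 0 = w" by (simp add: cycle_fun_def r0_m w_def)
  have G1: "cycle_fun m r0 1 = 0" "cycle_fun m r0 (m - 1) = 0"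
    using m by (simp_all add: cycle_fun_def r0_1[unfolded One_nat_def])
  have G2: "cycle_fun m r0 2 = - w" by (simp add: cycle_fun_def r0_pow w_def)
  have diag: "\<Sigma> r0 $ i $ i = 1" for i
    using G0 w idx[of i] by (auto simp: \<Sigma>_def gap_eq)
  have off: "\<Sigma> r0 $ i $ j = 0" if ij: "{i, j} \<in> E" "i \<noteq> j" for i j
  proof (cases "i \<in> set vs \<and> j \<in> set vs")
    case False
    then show ?thesis using ij by (auto simp: \<Sigma>_def)
  next
    case True
    then have "{i, j} \<in> cycle_edges vs" using chord ij by (auto simp: has_chord_def)
    then obtain a where a: "a < m" "{i, j} = {vs ! a, vs ! (Suc a mod m)}" unfolding edges by blast
    have *: "cycle_fun m r0 (gap m (Suc a mod m) a) = 0"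
    proof -
      have "gap m (Suc a mod m) a = 1" using a(1) m by (simp add: gap_Suc gap_eq)
      then show ?thesis using G1 by simp
    qed
    then have "cycle_fun m r0 (gap m a (Suc a mod m)) = 0"
      using cycle_fun_gap_commute[of a m "Suc a mod m"] a(1) m0 by simp
    with * have "cycle_fun m r0 (gap m (idx i) (idx j)) = 0"
      using a m0 by (auto simp: doubleton_eq_iff idx_nth)
    then show ?thesis using True by (simp add: \<Sigma>_def)
  qed
  \<comment> \<open>At distance 2 the value is r0 ^ 2 + r0 ^ (m - 2) = r0 ^ 2 - 1 = - w.\<close>
  have "\<Sigma> r0 $ (vs ! 2) $ (vs ! 0) = -1"
    using m G2 w nth_set[of 2] nth_set[of 0] by (simp add: \<Sigma>_def idx_nth gap_eq)
  moreover have "(mat 1 :: complex^'n^'n) $ (vs ! 2) $ (vs ! 0) \<noteq> -1" by (simp add: mat_def)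
  ultimately have "\<Sigma> r0 \<noteq> mat 1" by metis
  then show thesis
    using 1 diag off by (intro that[of "\<Sigma> r0"]) (auto simp: on_graph_def mat_def)
qed

section \<open>Perfect elimination orderings of chordal graphs\<close>

lemma simple_graph_irrefl: "simple_graph E \<Longrightarrow> {u, u} \<notin> E"
  by (auto simp: simple_graph_def)

text \<open>A shortest walk from \<^term>\<open>a\<close> to \<^term>\<open>b\<close> through \<^term>\<open>C\<close>, closed up by \<^term>\<open>x\<close>, would be a
  chordless cycle if \<^term>\<open>a\<close> and \<^term>\<open>b\<close> were not adjacent.\<close>
lemma chordal_common_neighbours_adjacent:
  fixes E :: "'n::finite set set"
  assumes simple: "simple_graph E" and "chordal E"
    and xa: "{x, a} \<in> E" and xb: "{x, b} \<in> E" and "a \<noteq> b"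
    and x: "x \<notin> C" "\<And>c. c \<in> C \<Longrightarrow> {x, c} \<notin> E"
    and conn: "(a, b) \<in> {(u, v). {u, v} \<in> E \<and> (u \<in> C \<or> u = a) \<and> (v \<in> C \<or> v = b)}\<^sup>*"
  shows "{a, b} \<in> E"
proof (rule ccontr)
  assume ab: "{a, b} \<notin> E"
  define walk where "walk n w \<longleftrightarrow> w 0 = a \<and> w n = b \<and> (\<forall>i<n. {w i, w (Suc i)} \<in> E) \<and>
    (\<forall>i. 0 < i \<and> i < n \<longrightarrow> w i \<in> C)" for n :: nat and w
  have "\<exists>n w. walk n w"
  proof -
    let ?Q = "{(u, v). {u, v} \<in> E \<and> (u \<in> C \<or> u = a) \<and> (v \<in> C \<or> v = b)}"
    obtain n where "(a, b) \<in> ?Q ^^ n" using conn rtrancl_imp_relpow by blast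
    then obtain w where w: "w 0 = a" "w n = b" "\<And>i. i < n \<Longrightarrow> (w i, w (Suc i)) \<in> ?Q"
      unfolding relpow_fun_conv by blast
    \<comment> \<open>An inner vertex is the target of one step and the source of the next, so
      outside \<open>C\<close> it would be both b and a.\<close>
    have "w i \<in> C" if "0 < i" "i < n" for i
      using w(3)[of i] w(3)[of "i - 1"] that \<open>a \<noteq> b\<close> by auto
    then have "walk n w" using w by (auto simp: walk_def)
    then show ?thesis by blast
  qed
  then obtain n where "\<exists>w. walk n w" and least: "\<And>m. m < n \<Longrightarrow> \<not> (\<exists>w. walk m w)"
    using exists_least_iff[of "\<lambda>n. \<exists>w. walk n w"] by blast
  then obtain w where w: "walk n w" by blast
  \<comment> \<open>Deletes the \<open>c\<close> vertices after position \<open>i\<close>: either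
    the walk returns to \<open>w i\<close> at position \<open>j\<close>, or an edge leads directly
    from \<open>w i\<close> to the first vertex kept. Both contradict minimality of the
    length.\<close>
  have shortcut: False
    if "i < j" "j \<le> n" "0 < c" "c \<le> j - i" "c = j - i \<and> w i = w j \<or> c < j - i \<and> {w i, w (i + 1 + c)} \<in> E"
    for i j c
  proof -
    define w' where "w' k = (if k \<le> i then w k else w (k + c))" for k
    have "{w' k, w' (Suc k)} \<in> E" if "k < n - c" for k
    proof (cases k i rule: linorder_cases)
      case equal
      then show ?thesis
        using \<open>_ \<or> _\<close> w that \<open>i < j\<close> by (auto simp: w'_def walk_def)
    qed (use w that in \<open>auto simp: w'_def walk_def\<close>)
    moreover have "w' k \<in> C" if "0 < k" "k < n - c" for k
      using w that by (auto simp: w'_def walk_def)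
    moreover have "w' (n - c) = b"
    proof (cases "n - c \<le> i")
      case True
      then have "j = n" "c = j - i" "n - c = i" using that by auto
      then show ?thesis using w that by (auto simp: w'_def walk_def)
    qed (use w that in \<open>auto simp: w'_def walk_def\<close>)
    ultimately have "walk (n - c) w'" using w by (simp add: walk_def w'_def)
    moreover have "n - c < n" using that by simp
    ultimately show False using least by blast
  qed
  have inj: "w i \<noteq> w j" if "i < j" "j \<le> n" for i j
    using shortcut[of i j "j - i"] that by auto
  have consecutive: "j = Suc i" if "i < j" "j \<le> n" "{w i, w j} \<in> E" for i j
  proof (rule ccontr)
    assume "j \<noteq> Suc i"
    with that(1) have "0 < j - i - 1" "j - i - 1 < j - i" "i + 1 + (j - i - 1) = j" by auto
    then show False using shortcut[of i j "j - i - 1"] that by (metis less_imp_le)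
  qed
  have n: "n \<ge> 2"
  proof (rule ccontr)
    assume "\<not> n \<ge> 2"
    then consider "n = 0" | "n = 1" by linarith
    then show False using w \<open>a \<noteq> b\<close> ab by cases (auto simp: walk_def)
  qed
  have w0: "w 0 = a" and wn: "w n = b" and w_edge: "\<And>i. i < n \<Longrightarrow> {w i, w (Suc i)} \<in> E"
    and wC: "\<And>i. 0 < i \<Longrightarrow> i < n \<Longrightarrow> w i \<in> C"
    using w by (auto simp: walk_def)
  have x_adj: "k = 0 \<or> k = n" if "k \<le> n" "{x, w k} \<in> E" for k
    using wC[of k] x(2) that by force
  have x_w: "x \<noteq> w k" if "k \<le> n" for k
  proof
    assume "x = w k"
    then have "k = 0 \<or> k = n" using wC[of k] x(1) that by force
    then show False using xa xb w0 wn \<open>x = w k\<close> simple_graph_irrefl[OF simple] by auto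
  qed
  \<comment> \<open>The cycle has n + 2 vertices, at least 4 because a and b are distinct and not
    adjacent.\<close>
  define vs where "vs = x # map w [0..<Suc n]"
  have len: "length vs = n + 2" by (simp add: vs_def)
  have nth: "vs ! 0 = x" "\<And>k. k \<le> n \<Longrightarrow> vs ! Suc k = w k"
    by (simp_all add: vs_def nth_append del: upt_Suc)
  have set: "set vs = insert x (w ` {..n})"
    by (auto simp: vs_def simp del: upt_Suc)
  have "inj_on w {0..<Suc n}"
    by (intro linorder_inj_onI) (auto dest: inj)
  moreover have "x \<notin> w ` {0..<Suc n}"
    using x_w by (metis imageE atLeastLessThan_iff less_Suc_eq_le)
  ultimately have "distinct vs"
    by (simp add: vs_def distinct_map del: upt_Suc)
  have edge: "{vs ! i, vs ! (Suc i mod length vs)} \<in> cycle_edges vs" if "i < length vs" for i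
    using that by (auto simp: cycle_edges_def)
  have in_cycle: "{x, a} \<in> cycle_edges vs" "{x, b} \<in> cycle_edges vs"
      "\<And>k. k < n \<Longrightarrow> {w k, w (Suc k)} \<in> cycle_edges vs"
  proof -
    show "{x, a} \<in> cycle_edges vs" using edge[of 0] nth(2)[of 0] by (simp add: len nth w0)
    show "{x, b} \<in> cycle_edges vs" using edge[of "Suc n"] nth(2)[of n]
      by (simp add: len nth wn insert_commute)
    fix k assume "k < n"
    then show "{w k, w (Suc k)} \<in> cycle_edges vs"
      using edge[of "Suc k"] nth(2)[of k] nth(2)[of "Suc k"] by (simp add: len)
  qed
  have "cycle_edges vs \<subseteq> E"
  proof
    fix e assume "e \<in> cycle_edges vs"
    then obtain i where i: "i < n + 2" "e = {vs ! i, vs ! (Suc i mod (n + 2))}"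
      by (auto simp: cycle_edges_def len)
    consider "i = 0" | k where "i = Suc k" "k < n" | "i = Suc n"
      using i(1) by (metis One_nat_def Suc_eq_plus1 add_2_eq_Suc' less_Suc_eq not0_implies_Suc not_less_eq)
    then show "e \<in> E"
    proof cases
      case 1 then show ?thesis using i xa nth(2)[of 0] by (simp add: nth w0)
    next
      case 2 then show ?thesis using i w_edge[of k] nth(2)[of k] nth(2)[of "Suc k"] by simp
    next
      case 3 then show ?thesis using i xb nth(2)[of n] by (simp add: nth wn insert_commute)
    qed
  qed
  then have "cycle_in E vs" using n \<open>distinct vs\<close> by (simp add: cycle_in_def len)
  then have "has_chord E vs" using \<open>chordal E\<close> n by (simp add: chordal_def len)
  then obtain u v where uv: "u \<in> set vs" "v \<in> set vs" "{u, v} \<in> E" "{u, v} \<notin> cycle_edges vs"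
    by (auto simp: has_chord_def)
  have no_x: False if "k \<le> n" "{x, w k} \<in> E" "{x, w k} \<notin> cycle_edges vs" for k
    using x_adj[OF that(1,2)] that(3) in_cycle w0 wn by auto
  have no_w: False if "i \<le> n" "j \<le> n" "i < j" "{w i, w j} \<in> E" "{w i, w j} \<notin> cycle_edges vs" for i j
    using consecutive[OF that(3,2,4)] that in_cycle(3)[of i] by auto
  have "u \<noteq> v" using uv(3) simple_graph_irrefl[OF simple] by auto
  consider k where "u = x" "v = w k" "k \<le> n" | k where "v = x" "u = w k" "k \<le> n"
    | i j where "u = w i" "v = w j" "i \<le> n" "j \<le> n" "i < j"
    | i j where "u = w i" "v = w j" "i \<le> n" "j \<le> n" "j < i"
  proof -
    have "u = x \<or> (\<exists>i\<le>n. u = w i)" "v = x \<or> (\<exists>j\<le>n. v = w j)" using uv(1,2) set by auto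
    with \<open>u \<noteq> v\<close> that show thesis by (metis linorder_neqE_nat)
  qed
  then show False
  proof cases
    case 1 then show ?thesis using uv no_x[of k] by simp
  next
    case 2 then show ?thesis using uv no_x[of k] by (simp add: insert_commute)
  next
    case 3 then show ?thesis using uv no_w[of i j] by simp
  next
    case 4 then show ?thesis using uv no_w[of j i] by (simp add: insert_commute)
  qed
qed

section \<open>Simplicial vertices and elimination orderings\<close>

definition simplicial :: "'n set set \<Rightarrow> 'n set \<Rightarrow> 'n \<Rightarrow> bool" where
  "simplicial E W z \<longleftrightarrow> (\<forall>u\<in>W. \<forall>v\<in>W. {z, u} \<in> E \<and> {z, v} \<in> E \<and> u \<noteq> v \<longrightarrow> {u, v} \<in> E)"

text \<open>Dirac's theorem in the form suited to induction: the new vertex is found in a component of the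
  non-neighbours of \<^term>\<open>x\<close>, whose boundary is a clique.\<close>
lemma simplicial_non_neighbour:
  fixes E :: "'n::finite set set"
  assumes simple: "simple_graph E" and chordal: "chordal E"
  shows "x \<in> W \<Longrightarrow> y \<in> W \<Longrightarrow> y \<noteq> x \<Longrightarrow> {x, y} \<notin> E \<Longrightarrow>
    \<exists>z\<in>W. z \<noteq> x \<and> {x, z} \<notin> E \<and> simplicial E W z"
proof (induction W arbitrary: x y rule: measure_induct_rule[where f = card])
  case (less W)
  define D where "D = {z \<in> W. z \<noteq> x \<and> {x, z} \<notin> E}"
  define R where "R = {(u, v). u \<in> D \<and> v \<in> D \<and> {u, v} \<in> E}"
  define C where "C = {z. (y, z) \<in> R\<^sup>*}"
  define B where "B = {b \<in> W. b \<notin> C \<and> (\<exists>c\<in>C. {b, c} \<in> E)}"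
  have "y \<in> D" using less.prems by (simp add: D_def)
  have "y \<in> C" by (simp add: C_def)
  have "z \<in> D" if "(y, z) \<in> R\<^sup>*" for z
    using that \<open>y \<in> D\<close> by induction (auto simp: R_def)
  then have CD: "C \<subseteq> D" by (auto simp: C_def)
  then have CW: "C \<subseteq> W" and xC: "x \<notin> C" "\<And>c. c \<in> C \<Longrightarrow> {x, c} \<notin> E" by (auto simp: D_def)
  \<comment> \<open>A boundary vertex not adjacent to \<open>x\<close> would itself belong to
    \<open>D\<close>, hence to the component \<open>C\<close>.\<close>
  have xB: "{x, b} \<in> E" if b: "b \<in> B" for b
  proof (rule ccontr)
    assume "{x, b} \<notin> E"
    obtain c where c: "c \<in> C" "{b, c} \<in> E" "b \<in> W" "b \<notin> C" using b by (auto simp: B_def)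
    then have "b \<noteq> x" using xC by auto
    with c \<open>{x, b} \<notin> E\<close> have "b \<in> D" by (simp add: D_def)
    then have "(c, b) \<in> R" using c CD by (auto simp: R_def insert_commute)
    then have "b \<in> C" using c(1) by (auto simp: C_def intro: rtrancl_into_rtrancl)
    then show False using c by simp
  qed
  define RC where "RC = {(u, v). u \<in> C \<and> v \<in> C \<and> {u, v} \<in> E}"
  have y_RC: "(y, z) \<in> RC\<^sup>*" if "z \<in> C" for z
  proof -
    have "(y, z) \<in> R\<^sup>*" using that by (simp add: C_def)
    then show ?thesis
    proof induction
      case (step u v)
      then have "u \<in> C" "v \<in> C" by (auto simp: C_def intro: rtrancl_into_rtrancl)
      then have "(u, v) \<in> RC" using step by (auto simp: RC_def R_def)
      then show ?case using step by (auto intro: rtrancl_into_rtrancl)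
    qed simp
  qed
  have "sym RC" by (auto simp: RC_def sym_def insert_commute)
  have B_clique: "{a, b} \<in> E" if ab: "a \<in> B" "b \<in> B" "a \<noteq> b" for a b
  proof -
    let ?Q = "{(u, v). {u, v} \<in> E \<and> (u \<in> C \<or> u = a) \<and> (v \<in> C \<or> v = b)}"
    obtain c1 c2 where c: "c1 \<in> C" "{a, c1} \<in> E" "c2 \<in> C" "{b, c2} \<in> E"
      using ab by (auto simp: B_def)
    have "(c1, y) \<in> RC\<^sup>*" using y_RC[OF c(1)] \<open>sym RC\<close> by (meson sym_rtrancl symE)
    then have "(c1, c2) \<in> RC\<^sup>*" using y_RC[OF c(3)] by simp
    moreover have "RC \<subseteq> ?Q" by (auto simp: RC_def)
    ultimately have "(c1, c2) \<in> ?Q\<^sup>*" using rtrancl_mono by blast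
    moreover have "(a, c1) \<in> ?Q" "(c2, b) \<in> ?Q" using c by (auto simp: insert_commute)
    ultimately have "(a, b) \<in> ?Q\<^sup>*" by (meson converse_rtrancl_into_rtrancl rtrancl.rtrancl_into_rtrancl)
    from chordal_common_neighbours_adjacent[OF simple chordal xB[OF ab(1)] xB[OF ab(2)] ab(3) xC this]
    show ?thesis .
  qed
  \<comment> \<open>\<open>H\<close> omits \<open>x\<close>, so the induction hypothesis applies to
    it, and it contains all neighbours in \<open>W\<close> of vertices of \<open>C\<close>.\<close>
  define H where "H = C \<union> B"
  have "H \<subseteq> W" using CW by (auto simp: H_def B_def)
  moreover have "x \<notin> B" using xB simple_graph_irrefl[OF simple] by blast
  then have "x \<notin> H" using xC by (simp add: H_def)
  ultimately have "H \<subset> W" using less.prems(1) by blast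
  then have "card H < card W" by (simp add: psubset_card_mono)
  note IH = less.IH[OF this]
  \<comment> \<open>The induction hypothesis may return a vertex of \<open>B\<close>. Starting from
    some b in \<open>B\<close> with a non-neighbour in \<open>H\<close>, this is excluded since
    \<open>B\<close> is a clique; if there is no such b, every vertex of \<open>B\<close> is
    adjacent to all of \<open>H\<close>, so a non-neighbour of some c in \<open>C\<close> is not in
    \<open>B\<close>. Otherwise \<open>H\<close> is complete.\<close>
  have "\<exists>z\<in>C. simplicial E H z"
  proof (cases "\<exists>b\<in>B. \<exists>h\<in>H. h \<noteq> b \<and> {b, h} \<notin> E")
    case True
    then obtain b h where b: "b \<in> B" "h \<in> H" "h \<noteq> b" "{b, h} \<notin> E" by blast
    then obtain z where z: "z \<in> H" "z \<noteq> b" "{b, z} \<notin> E" "simplicial E H z"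
      using IH[of b h] by (auto simp: H_def)
    then have "z \<notin> B" using B_clique[OF b(1)] by auto
    then show ?thesis using z by (auto simp: H_def)
  next
    case dom: False
    show ?thesis
    proof (cases "\<exists>c\<in>C. \<exists>h\<in>H. h \<noteq> c \<and> {c, h} \<notin> E")
      case True
      then obtain c h where c: "c \<in> C" "h \<in> H" "h \<noteq> c" "{c, h} \<notin> E" by blast
      then obtain z where z: "z \<in> H" "z \<noteq> c" "{c, z} \<notin> E" "simplicial E H z"
        using IH[of c h] by (auto simp: H_def)
      then have "z \<notin> B" using dom c(1) by (metis H_def UnI1 insert_commute)
      then show ?thesis using z by (auto simp: H_def)
    next
      case False
      with dom have "{u, v} \<in> E" if "u \<in> H" "v \<in> H" "u \<noteq> v" for u v
        using that by (metis H_def UnE)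
      then have "simplicial E H y" by (simp add: simplicial_def)
      then show ?thesis using \<open>y \<in> C\<close> by blast
    qed
  qed
  then obtain z where z: "z \<in> C" "simplicial E H z" by blast
  have "u \<in> H" if "u \<in> W" "{z, u} \<in> E" for u
    using that z(1) by (auto simp: H_def B_def insert_commute)
  then have "simplicial E W z" using z(2) by (auto simp: simplicial_def)
  then show ?case using z(1) CD by (auto simp: D_def)
qed

lemma chordal_simplicial_vertex:
  fixes E :: "'n::finite set set"
  assumes "simple_graph E" "chordal E" "W \<noteq> {}"
  obtains z where "z \<in> W" "simplicial E W z"
proof (cases "\<exists>x\<in>W. \<exists>y\<in>W. y \<noteq> x \<and> {x, y} \<notin> E")
  case True
  then show thesis using simplicial_non_neighbour[OF assms(1,2)] that by metis
next
  case False
  then have "simplicial E W z" for z by (auto simp: simplicial_def)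
  then show thesis using assms(3) that by blast
qed

definition perfect_elimination :: "'n set set \<Rightarrow> ('n \<Rightarrow> nat) \<Rightarrow> bool" where
  "perfect_elimination E f \<longleftrightarrow> inj f \<and> (\<forall>v. simplicial E {u. f v < f u} v)"

lemma chordal_perfect_elimination:
  fixes E :: "'n::finite set set"
  assumes "simple_graph E" "chordal E"
  obtains f where "perfect_elimination E f"
proof -
  have "\<exists>f :: 'n \<Rightarrow> nat. inj_on f W \<and> (\<forall>v\<in>W. simplicial E {u \<in> W. f v < f u} v)" for W :: "'n set"
  proof (induction W rule: measure_induct_rule[where f = card])
    case (less W)
    show ?case
    proof (cases "W = {}")
      case False
      obtain z where z: "z \<in> W" "simplicial E W z"
        using chordal_simplicial_vertex[OF assms False] by blast
      then have "card (W - {z}) < card W" by (meson card_Diff1_less finite)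
      then obtain f :: "'n \<Rightarrow> nat" where f: "inj_on f (W - {z})"
        "\<And>v. v \<in> W - {z} \<Longrightarrow> simplicial E {u \<in> W - {z}. f v < f u} v"
        using less.IH by metis
      \<comment> \<open>Rank 0 eliminates \<open>z\<close> first, and the shift by
        \<open>Suc\<close> keeps all other ranks above it.\<close>
      define g where "g u = (if u = z then 0 else Suc (f u))" for u
      have "inj_on g W" using f(1) by (auto simp: inj_on_def g_def)
      moreover have "simplicial E {u \<in> W. g v < g u} v" if "v \<in> W" for v
      proof (cases "v = z")
        case True
        then show ?thesis using z(2) by (auto simp: simplicial_def)
      next
        case False
        then have "{u \<in> W. g v < g u} = {u \<in> W - {z}. f v < f u}" by (auto simp: g_def)
        then show ?thesis using f(2) that False by simp
      qed
      ultimately show ?thesis by blast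
    qed simp
  qed
  from this[of UNIV] show thesis using that by (auto simp: perfect_elimination_def)
qed

section \<open>Elimination\<close>

lemma sum_eq_single:
  assumes "finite A" "i \<in> A" "\<And>c. c \<in> A \<Longrightarrow> c \<noteq> i \<Longrightarrow> g c = 0"
  shows "sum g A = g i"
  using sum.mono_neutral_right[of A "{i}" g] assms by auto

lemma decreasing_rank_induct:
  fixes f :: "'n::finite \<Rightarrow> nat"
  assumes "\<And>i. (\<And>j. f i < f j \<Longrightarrow> P j) \<Longrightarrow> P i"
  shows "P i"
proof (induction i rule: measure_induct_rule[where f = "\<lambda>i. Max (range f) - f i"])
  case (less i)
  have "P j" if "f i < f j" for j
  proof -
    have "f j \<le> Max (range f)" by simp
    with that have "f i < Max (range f)" by (rule order_less_le_trans)
    with that show ?thesis by (intro less diff_less_mono2)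
  qed
  then show ?case by (rule assms)
qed

definition unitriangular :: "('n \<Rightarrow> nat) \<Rightarrow> complex^'n^'n \<Rightarrow> bool" where
  "unitriangular f L \<longleftrightarrow> (\<forall>c. L $ c $ c = 1) \<and> (\<forall>c j. j \<noteq> c \<longrightarrow> \<not> f c < f j \<longrightarrow> L $ c $ j = 0)"

text \<open>The product of the transpose of \<open>L\<close>, the diagonal matrix of
  \<open>d\<close>, and \<open>L\<close>.\<close>

definition LDL :: "complex^'n^'n \<Rightarrow> ('n \<Rightarrow> complex) \<Rightarrow> complex^'n^'n" where
  "LDL L d = (\<chi> i j. \<Sum>c\<in>UNIV. d c * L $ c $ i * L $ c $ j)"

lemma LDL_mult_vec: "(LDL L d *v x) $ i = (\<Sum>c\<in>UNIV. L $ c $ i * (d c * (L *v x) $ c))"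
proof -
  have "(LDL L d *v x) $ i = (\<Sum>j\<in>UNIV. \<Sum>c\<in>UNIV. d c * L $ c $ i * L $ c $ j * x $ j)"
    by (simp add: LDL_def matrix_vector_mult_def sum_distrib_right)
  also have "\<dots> = (\<Sum>c\<in>UNIV. \<Sum>j\<in>UNIV. d c * L $ c $ i * L $ c $ j * x $ j)"
    by (rule sum.swap)
  finally show ?thesis
    by (simp add: matrix_vector_mult_def sum_distrib_left mult_ac)
qed

lemma unitriangular_transpose_mult:
  assumes "unitriangular f L" and "\<And>c. f c < f i \<Longrightarrow> v c = 0"
  shows "(\<Sum>c\<in>UNIV. L $ c $ i * v c) = v i"
proof -
  have "(\<Sum>c\<in>UNIV. L $ c $ i * v c) = L $ i $ i * v i"
  proof (rule sum_eq_single)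
    fix c :: 'a assume "c \<noteq> i"
    then show "L $ c $ i * v c = 0"
      using assms by (cases "f c < f i") (auto simp: unitriangular_def)
  qed auto
  then show ?thesis using assms(1) by (simp add: unitriangular_def)
qed

text \<open>With D the diagonal matrix of \<open>d\<close>, \<open>D ** L ** \<Sigma>\<close> is the
  inverse of the transpose of \<open>L\<close>, again unitriangular in the opposite direction. The
  induction is forward substitution.\<close>

lemma LDL_right_inverse:
  assumes L: "unitriangular f L" and inv: "LDL L d ** \<Sigma> = mat 1"
  shows "f i \<le> f u \<Longrightarrow> d i * (L ** \<Sigma>) $ i $ u = (if i = u then 1 else 0)"
proof (induction i rule: measure_induct_rule[where f = f])
  case (less i)
  let ?v = "\<lambda>c. d c * (L *v column u \<Sigma>) $ c"
  have col: "(A *v column u \<Sigma>) $ c = (A ** \<Sigma>) $ c $ u" for A :: "complex^'a^'a" and c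
    by (simp add: matrix_vector_mult_def matrix_matrix_mult_def column_def)
  have "?v c = 0" if "f c < f i" for c
    using less.IH[OF that] less.prems that by (auto simp: col)
  then have "?v i = (LDL L d *v column u \<Sigma>) $ i"
    by (simp add: LDL_mult_vec unitriangular_transpose_mult[OF L])
  then show ?case by (simp add: col inv mat_def)
qed

text \<open>The kernel is trivial: forward substitution through the transpose of \<open>L\<close>,
  then backward substitution through \<open>L\<close>.\<close>

lemma LDL_invertible:
  assumes L: "unitriangular f L" and d: "\<And>c. d c \<noteq> 0"
  shows "\<exists>\<Sigma>. LDL L d ** \<Sigma> = mat 1"
proof -
  have "x = 0" if x: "LDL L d *v x = 0" for x
  proof -
    have "d i * (L *v x) $ i = 0" for i
    proof (induction i rule: measure_induct_rule[where f = f])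
      case (less i)
      then show ?case
        using unitriangular_transpose_mult[OF L, of i "\<lambda>c. d c * (L *v x) $ c"] x
        by (simp flip: LDL_mult_vec)
    qed
    then have Lx: "(L *v x) $ i = 0" for i using d by simp
    have "x $ i = 0" for i
    proof (induction i rule: decreasing_rank_induct[where f = f])
      case (1 i)
      have "(\<Sum>j\<in>UNIV. L $ i $ j * x $ j) = L $ i $ i * x $ i"
      proof (rule sum_eq_single)
        fix j assume "j \<noteq> i"
        then show "L $ i $ j * x $ j = 0"
          using 1 L by (cases "f i < f j") (auto simp: unitriangular_def)
      qed auto
      then show ?case using Lx[of i] L by (simp add: matrix_vector_mult_def unitriangular_def)
    qed
    then show ?thesis by (simp add: vec_eq_iff)
  qed
  then show ?thesis using matrix_left_invertible_ker matrix_left_right_inverse by blast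
qed

text \<open>Unnormalized Gaussian elimination: row i of the Schur complement left after all vertices
  of smaller rank are eliminated, with pivots on the diagonal. Division by a zero pivot gives 0, so
  this reading requires the earlier pivots to be nonzero.\<close>

function pivot_row :: "('n::finite \<Rightarrow> nat) \<Rightarrow> complex^'n^'n \<Rightarrow> 'n \<Rightarrow> 'n \<Rightarrow> complex" where
  "pivot_row f K i j = K $ i $ j -
    (\<Sum>c | f c < f i. pivot_row f K c i * pivot_row f K c j / pivot_row f K c c)"
  by auto
termination by (relation "Wellfounded.measure (\<lambda>(f, K, i, j). f i)") auto

declare pivot_row.simps [simp del]

definition later_neighbours :: "'n set set \<Rightarrow> ('n \<Rightarrow> nat) \<Rightarrow> 'n \<Rightarrow> 'n set" where
  "later_neighbours E f i = {j. f i < f j \<and> {i, j} \<in> E}"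

lemma later_neighbours_clique:
  "perfect_elimination E f \<Longrightarrow> a \<in> later_neighbours E f i \<Longrightarrow> b \<in> later_neighbours E f i \<Longrightarrow> on_graph E a b"
  by (auto simp: perfect_elimination_def simplicial_def later_neighbours_def on_graph_def)

text \<open>There is no fill-in because the later neighbours of an eliminated vertex form a clique.\<close>
lemma pivot_row_on_graph:
  assumes f: "perfect_elimination E f" and K: "K \<in> L_space E"
  shows "f i < f j \<Longrightarrow> j \<notin> later_neighbours E f i \<Longrightarrow> pivot_row f K i j = 0"
proof (induction i arbitrary: j rule: measure_induct_rule[where f = f])
  case (less i)
  then have ij: "\<not> on_graph E i j" by (auto simp: on_graph_def later_neighbours_def)
  have "pivot_row f K c i * pivot_row f K c j = 0" if "f c < f i" for c
  proof -
    have "f c < f j" using that less.prems by simp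
    have "i \<notin> later_neighbours E f c \<or> j \<notin> later_neighbours E f c"
      using later_neighbours_clique[OF f] ij by blast
    then show ?thesis using less.IH[OF that] that \<open>f c < f j\<close> by auto
  qed
  moreover have "K $ i $ j = 0" using K ij by (simp add: L_space_iff)
  ultimately show ?case by (auto simp: pivot_row.simps[of f K i j] intro!: sum.neutral)
qed

definition pivot_matrix :: "('n::finite \<Rightarrow> nat) \<Rightarrow> complex^'n^'n \<Rightarrow> complex^'n^'n" where
  "pivot_matrix f K = (\<chi> c j. if j = c then 1 else if f c < f j then pivot_row f K c j / pivot_row f K c c else 0)"

lemma unitriangular_pivot_matrix: "unitriangular f (pivot_matrix f K)"
  by (simp add: unitriangular_def pivot_matrix_def)

text \<open>For \<open>f i \<le> f j\<close> the sum over c stops at c = i, whose term is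
  \<open>pivot_row f K i j\<close>; the claim is then the recursion rearranged. Symmetry covers the
  other half.\<close>

lemma LDL_pivot_matrix:
  assumes "inj f" "K \<in> sym_matrices" and piv: "\<And>c. pivot_row f K c c \<noteq> 0"
  shows "LDL (pivot_matrix f K) (\<lambda>c. pivot_row f K c c) = K"
proof -
  let ?M = "LDL (pivot_matrix f K) (\<lambda>c. pivot_row f K c c)"
  have le: "?M $ i $ j = K $ i $ j" if ij: "f i \<le> f j" for i j
  proof -
    let ?t = "\<lambda>c. pivot_row f K c c * pivot_matrix f K $ c $ i * pivot_matrix f K $ c $ j"
    have "?M $ i $ j = sum ?t UNIV" by (simp add: LDL_def)
    also have "\<dots> = sum ?t (insert i {c. f c < f i})"
    proof (rule sum.mono_neutral_right)
      show "\<forall>c\<in>UNIV - insert i {c. f c < f i}. ?t c = 0"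
        by (auto simp: pivot_matrix_def)
    qed auto
    also have "\<dots> = ?t i + sum ?t {c. f c < f i}" by simp
    also have "sum ?t {c. f c < f i} = (\<Sum>c | f c < f i. pivot_row f K c i * pivot_row f K c j / pivot_row f K c c)"
      using ij piv by (intro sum.cong) (auto simp: pivot_matrix_def)
    also have "?t i = pivot_row f K i j"
      using ij piv[of i] \<open>inj f\<close> by (auto simp: pivot_matrix_def inj_eq le_less)
    finally show ?thesis by (simp add: pivot_row.simps[of f K i j])
  qed
  have "?M $ i $ j = ?M $ j $ i" for i j by (simp add: LDL_def mult_ac)
  then have "?M $ i $ j = K $ i $ j" for i j
    using le[of i j] le[of j i] assms(2) by (cases "f i \<le> f j") (auto simp: sym_matrices_iff)
  then show ?thesis by (simp add: vec_eq_iff)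
qed

text \<open>Every correction term has the factor \<open>pivot_row\<close> at (c, i) with c different
  from i, which tends to 0 while its denominator tends to 1. Hence the pivots are nonzero near the
  identity.\<close>

lemma tendsto_pivot_row:
  "((\<lambda>t. pivot_row f (line (mat 1) K t) i j) \<longlongrightarrow> (if i = j then 1 else 0)) (at 0)"
proof (induction i arbitrary: j rule: measure_induct_rule[where f = f])
  case (less i)
  have K: "((\<lambda>t. line (mat 1) K t $ i $ j) \<longlongrightarrow> (mat 1 :: complex^'a^'a) $ i $ j) (at 0)"
    by (intro tendsto_vec_nth tendsto_line)
  have "((\<lambda>t. pivot_row f (line (mat 1) K t) c i * pivot_row f (line (mat 1) K t) c j /
      pivot_row f (line (mat 1) K t) c c) \<longlongrightarrow> 0) (at 0)" if "f c < f i" for c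
  proof -
    have "c \<noteq> i" using that by auto
    show ?thesis
      using tendsto_divide[OF tendsto_mult[OF less(1)[OF that, of i] less(1)[OF that, of j]] less(1)[OF that, of c]] \<open>c \<noteq> i\<close>
      by simp
  qed
  then have "((\<lambda>t. \<Sum>c | f c < f i. pivot_row f (line (mat 1) K t) c i * pivot_row f (line (mat 1) K t) c j /
      pivot_row f (line (mat 1) K t) c c) \<longlongrightarrow> (\<Sum>c | f c < f i. 0)) (at 0)"
    by (intro tendsto_sum) simp
  from tendsto_diff[OF K this] show ?case
    by (simp add: pivot_row.simps[of f _ i j] mat_def)
qed

section \<open>Regression equations\<close>

text \<open>The principal submatrix on \<^term>\<open>W\<close>, padded by the identity so that its type does not depend on
  \<^term>\<open>W\<close>.\<close>
definition pad :: "'n set \<Rightarrow> complex^'n^'n \<Rightarrow> complex^'n^'n" where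
  "pad W S = (\<chi> a b. if a \<in> W \<and> b \<in> W then S $ a $ b else if a = b then 1 else 0)"

definition regressand :: "'n set \<Rightarrow> 'n \<Rightarrow> complex^'n^'n \<Rightarrow> complex^'n" where
  "regressand W i S = (\<chi> a. if a \<in> W then S $ a $ i else 0)"

lemma pad_mult_vec:
  assumes "\<And>a. a \<notin> W \<Longrightarrow> x $ a = 0"
  shows "(pad W S *v x) $ a = (if a \<in> W then \<Sum>b\<in>W. S $ a $ b * x $ b else 0)"
proof (cases "a \<in> W")
  case True
  have "(\<Sum>b\<in>UNIV. pad W S $ a $ b * x $ b) = (\<Sum>b\<in>W. pad W S $ a $ b * x $ b)"
    using assms by (intro sum.mono_neutral_right) auto
  also have "\<dots> = (\<Sum>b\<in>W. S $ a $ b * x $ b)"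
    using True by (intro sum.cong) (auto simp: pad_def)
  finally show ?thesis using True by (simp add: matrix_vector_mult_def)
next
  case False
  have "(\<Sum>b\<in>UNIV. pad W S $ a $ b * x $ b) = pad W S $ a $ a * x $ a"
    using False by (intro sum_eq_single) (auto simp: pad_def)
  then show ?thesis using False assms by (simp add: matrix_vector_mult_def)
qed

lemma pad_support:
  assumes "pad W S *v x = regressand W i S" "a \<notin> W"
  shows "x $ a = 0"
proof -
  have "(\<Sum>b\<in>UNIV. pad W S $ a $ b * x $ b) = pad W S $ a $ a * x $ a"
    using assms(2) by (intro sum_eq_single) (auto simp: pad_def)
  moreover have "(pad W S *v x) $ a = 0" using assms by (simp add: regressand_def)
  ultimately show ?thesis using assms(2) by (simp add: matrix_vector_mult_def pad_def)
qed

definition cramer_det :: "'n set \<Rightarrow> 'n \<Rightarrow> 'n \<Rightarrow> complex^'n^'n \<Rightarrow> complex" where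
  "cramer_det W i w S = det (\<chi> a b. if b = w then regressand W i S $ a else pad W S $ a $ b)"

lemma cramer_det_eq:
  "pad W S *v x = regressand W i S \<Longrightarrow> cramer_det W i w S = x $ w * det (pad W S)"
  using cramer_lemma[of w "pad W S" x] by (simp add: cramer_det_def cong: if_cong)

text \<open>The regression of row \<^term>\<open>i\<close> on the rows in \<^term>\<open>W\<close>, with the denominators in Cramer's rule
  cleared.\<close>
definition regression_poly :: "'n set \<Rightarrow> 'n \<Rightarrow> 'n \<Rightarrow> complex^'n^'n \<Rightarrow> complex" where
  "regression_poly W i u S = det (pad W S) * S $ i $ u - (\<Sum>w\<in>W. cramer_det W i w S * S $ w $ u)"

lemma matrix_polynomial_pad: "matrix_polynomial (\<lambda>S. pad W S $ a $ b)"
  unfolding pad_def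
  by (cases "a \<in> W \<and> b \<in> W") (auto intro: matrix_polynomial.entry matrix_polynomial.const)

lemma matrix_polynomial_cramer_det: "matrix_polynomial (cramer_det W i w)"
  unfolding cramer_det_def
proof (rule matrix_polynomial_det)
  fix a b
  show "matrix_polynomial (\<lambda>M. (\<chi> a b. if b = w then regressand W i M $ a else pad W M $ a $ b) $ a $ b)"
    using matrix_polynomial_pad[of W a b]
    by (cases "b = w"; cases "a \<in> W")
      (auto simp: regressand_def intro: matrix_polynomial.entry matrix_polynomial.const)
qed

lemma matrix_polynomial_regression_poly:
  fixes W :: "'n::finite set"
  shows "matrix_polynomial (regression_poly W i u)"
  unfolding regression_poly_def
  by (intro matrix_polynomial_diff matrix_polynomial_sum matrix_polynomial.mult matrix_polynomial_det
      matrix_polynomial_pad matrix_polynomial_cramer_det matrix_polynomial.entry) simp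

text \<open>Row i of \<open>L ** \<Sigma>\<close>, for the factor \<open>L\<close> of
  \<open>K\<close>, vanishes in all later columns. In the columns of the later neighbours this says
  that the negated row of \<open>L\<close> solves the regression system; Cramer's identity, valid
  even if its determinant is 0, then gives the cleared equation in column u.\<close>

lemma regression_poly_eq_0_if_pivots:
  assumes f: "perfect_elimination E f" and K: "K \<in> L_space E" "\<And>c. pivot_row f K c c \<noteq> 0"
    and inv: "K ** \<Sigma> = mat 1" and iu: "f i < f u"
  shows "regression_poly (later_neighbours E f i) i u \<Sigma> = 0"
proof -
  let ?N = "later_neighbours E f i"
  let ?L = "pivot_matrix f K"
  have K_sym: "K \<in> sym_matrices" and "inj f"
    using K f by (auto simp: L_space_def perfect_elimination_def)
  then have LDL: "LDL ?L (\<lambda>c. pivot_row f K c c) = K" using K(2) by (intro LDL_pivot_matrix)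
  have \<Sigma>_sym: "\<Sigma> $ a $ b = \<Sigma> $ b $ a" for a b
    using inverse_sym[OF K_sym inv] by (simp add: sym_matrices_iff)
  define x :: "complex^'a" where "x = (\<chi> w. if w \<in> ?N then - ?L $ i $ w else 0)"
  have reg: "\<Sigma> $ i $ v = (\<Sum>w\<in>?N. x $ w * \<Sigma> $ w $ v)" if "f i < f v" for v
  proof -
    have "i \<noteq> v" using that by auto
    then have "(?L ** \<Sigma>) $ i $ v = 0"
      using LDL_right_inverse[OF unitriangular_pivot_matrix[of f K], of "\<lambda>c. pivot_row f K c c" \<Sigma> i v] that K(2)
      by (auto simp: LDL inv)
    moreover have "(?L ** \<Sigma>) $ i $ v = (\<Sum>w\<in>insert i ?N. ?L $ i $ w * \<Sigma> $ w $ v)"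
      unfolding matrix_matrix_mult_def vec_lambda_beta
    proof (rule sum.mono_neutral_right)
      show "\<forall>w\<in>UNIV - insert i ?N. ?L $ i $ w * \<Sigma> $ w $ v = 0"
        using pivot_row_on_graph[OF f K(1), of i] by (auto simp: pivot_matrix_def)
    qed auto
    moreover have "i \<notin> ?N" by (simp add: later_neighbours_def)
    ultimately have "0 = ?L $ i $ i * \<Sigma> $ i $ v + (\<Sum>w\<in>?N. ?L $ i $ w * \<Sigma> $ w $ v)" by simp
    also have "?L $ i $ i = 1" by (simp add: pivot_matrix_def)
    also have "(\<Sum>w\<in>?N. ?L $ i $ w * \<Sigma> $ w $ v) = - (\<Sum>w\<in>?N. x $ w * \<Sigma> $ w $ v)"
      unfolding sum_negf[symmetric] by (intro sum.cong) (auto simp: x_def)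
    finally show ?thesis by simp
  qed
  have supp: "a \<notin> ?N \<Longrightarrow> x $ a = 0" for a by (simp add: x_def)
  have "pad ?N \<Sigma> *v x = regressand ?N i \<Sigma>"
  proof (intro iffD2[OF vec_eq_iff] allI)
    fix a
    have "(\<Sum>b\<in>?N. \<Sigma> $ a $ b * x $ b) = \<Sigma> $ a $ i" if "a \<in> ?N"
    proof -
      have "f i < f a" using that by (simp add: later_neighbours_def)
      then have "\<Sigma> $ a $ i = (\<Sum>b\<in>?N. x $ b * \<Sigma> $ b $ a)" using reg \<Sigma>_sym[of a i] by simp
      then show ?thesis using \<Sigma>_sym[of a] by (simp add: mult.commute)
    qed
    then show "(pad ?N \<Sigma> *v x) $ a = regressand ?N i \<Sigma> $ a"
      by (simp add: pad_mult_vec[OF supp] regressand_def)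
  qed
  note cramer = cramer_det_eq[OF this]
  show ?thesis
    by (simp add: regression_poly_def cramer reg[OF iu] sum_distrib_left mult_ac)
qed

text \<open>The pivots do not vanish near the identity, and the polynomial identity obtained there on the line from
  the identity to \<^term>\<open>K\<close> extends to the whole line.\<close>
lemma regression_poly_inverse:
  assumes f: "perfect_elimination E f" and K: "K \<in> L_space E" "K ** \<Sigma> = mat 1" and iu: "f i < f u"
  shows "regression_poly (later_neighbours E f i) i u \<Sigma> = 0"
proof -
  let ?p = "regression_poly (later_neighbours E f i) i u"
  obtain d N q where d: "d \<noteq> 0" "\<And>t. det (line (mat 1) K t) = poly d t"
    and q: "\<And>t \<Sigma>. line (mat 1) K t ** \<Sigma> = mat 1 \<Longrightarrow> ?p (\<Sigma> + 0) * poly d t ^ N = poly q t"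
    using matrix_polynomial_inverse_line[OF matrix_polynomial_regression_poly matrix_mul_lid, of K _ i u 0]
    by blast
  have "eventually (\<lambda>t. pivot_row f (line (mat 1) K t) c c \<noteq> 0) (at 0)" for c
    using tendsto_imp_eventually_ne[OF tendsto_pivot_row[of f K c c], of 0] by simp
  then have "eventually (\<lambda>t. \<forall>c. pivot_row f (line (mat 1) K t) c c \<noteq> 0) (at 0)"
    by (rule eventually_all_finite)
  with poly_frequently_nonzero[OF d(1), of 0]
  have "eventually (\<lambda>t. poly q t = 0) (at 0)"
  proof eventually_elim
    case (elim t)
    let ?K = "line (mat 1) K t"
    have "?K ** matrix_inv ?K = mat 1"
      using elim(1) by (intro matrix_inv_inverse) (simp add: invertible_det_nz d(2))
    moreover have "?K \<in> L_space E" by (intro line_L_space mat_1_L_space K)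
    ultimately have "?p (matrix_inv ?K) = 0"
      using elim(2) by (intro regression_poly_eq_0_if_pivots[OF f _ _ _ iu]) auto
    then show ?case using q[OF \<open>?K ** matrix_inv ?K = mat 1\<close>] by simp
  qed
  then have "eventually (\<lambda>t::complex. False) (at 0)" if "q \<noteq> 0"
    using poly_frequently_nonzero[OF that, of 0] by eventually_elim simp
  then have "q = 0" by auto
  moreover have "poly d 1 \<noteq> 0"
    using d(2)[of 1] K(2) by (metis invertible_det_nz invertible_right_inverse line_1)
  ultimately show ?thesis using q[of 1 \<Sigma>] K(2) by simp
qed

text \<open>The zero set of a polynomial is closed, so the equation passes from the inverses to
  their closure.\<close>

lemma regression_poly_L_inverse:
  assumes "perfect_elimination E f" and "\<Sigma> \<in> L_inverse E" and "f i < f u"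
  shows "regression_poly (later_neighbours E f i) i u \<Sigma> = 0"
proof -
  let ?p = "regression_poly (later_neighbours E f i) i u"
  have "closed {\<Sigma>. ?p \<Sigma> = 0}"
    by (intro closed_Collect_eq continuous_matrix_polynomial matrix_polynomial_regression_poly continuous_on_const)
  then have "L_inverse E \<subseteq> {\<Sigma>. ?p \<Sigma> = 0}"
    unfolding L_inverse_def inverses_eq
    using regression_poly_inverse[OF assms(1) _ _ assms(3)] by (intro closure_minimal) auto
  then show ?thesis using assms(2) by auto
qed

text \<open>The later neighbours of i form a clique together with i, so the regression coefficients
  depend on graph entries only and are those of \<open>S\<close>. Descending through the ordering,
  they determine row i from entries between later vertices.\<close>

lemma critical_point_unique:
  assumes f: "perfect_elimination E f"
    and det: "\<And>i. det (pad (later_neighbours E f i) S) \<noteq> 0"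
    and 1: "\<Sigma>1 \<in> L_inverse E" "\<And>i j. on_graph E i j \<Longrightarrow> \<Sigma>1 $ i $ j = S $ i $ j"
    and 2: "\<Sigma>2 \<in> L_inverse E" "\<And>i j. on_graph E i j \<Longrightarrow> \<Sigma>2 $ i $ j = S $ i $ j"
  shows "\<Sigma>1 = \<Sigma>2"
proof -
  let ?N = "later_neighbours E f"
  define x where "x i w = cramer_det (?N i) i w S / det (pad (?N i) S)" for i w
  have reg: "\<Sigma> $ i $ u = (\<Sum>w\<in>?N i. x i w * \<Sigma> $ w $ u)"
    if \<Sigma>: "\<Sigma> \<in> L_inverse E" "\<And>i j. on_graph E i j \<Longrightarrow> \<Sigma> $ i $ j = S $ i $ j" and iu: "f i < f u" for \<Sigma> i u
  proof -
    have pad: "pad (?N i) \<Sigma> = pad (?N i) S"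
      using \<Sigma>(2) later_neighbours_clique[OF f, of _ i] by (auto simp: pad_def vec_eq_iff)
    have "on_graph E a i" if "a \<in> ?N i" for a
      using that by (simp add: on_graph_def later_neighbours_def insert_commute)
    then have "regressand (?N i) i \<Sigma> = regressand (?N i) i S"
      using \<Sigma>(2) by (auto simp: regressand_def vec_eq_iff)
    then have "cramer_det (?N i) i w \<Sigma> = cramer_det (?N i) i w S" for w
      by (simp only: cramer_det_def pad)
    then have "det (pad (?N i) S) * \<Sigma> $ i $ u = (\<Sum>w\<in>?N i. cramer_det (?N i) i w S * \<Sigma> $ w $ u)"
      using regression_poly_L_inverse[OF f \<Sigma>(1) iu] by (simp add: regression_poly_def pad)
    then have "\<Sigma> $ i $ u = (\<Sum>w\<in>?N i. cramer_det (?N i) i w S * \<Sigma> $ w $ u) / det (pad (?N i) S)"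
      using det[of i] by (simp add: field_simps)
    then show ?thesis by (simp add: x_def sum_divide_distrib)
  qed
  have sym: "\<Sigma>1 $ i $ j = \<Sigma>1 $ j $ i" "\<Sigma>2 $ i $ j = \<Sigma>2 $ j $ i" for i j
    using 1(1) 2(1) L_inverse_sym sym_matrices_iff by blast+
  have "inj f" using f by (simp add: perfect_elimination_def)
  have eq: "\<forall>u. f i \<le> f u \<longrightarrow> \<Sigma>1 $ i $ u = \<Sigma>2 $ i $ u" for i
  proof (induction i rule: decreasing_rank_induct[where f = f])
    case (1 i)
    show ?case
    proof (intro allI impI)
      fix u assume "f i \<le> f u"
      then consider "i = u" | "f i < f u" using \<open>inj f\<close> by (auto simp: le_less inj_eq)
      then show "\<Sigma>1 $ i $ u = \<Sigma>2 $ i $ u"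
      proof cases
        case 1
        then show ?thesis using assms(4,6) by simp
      next
        case iu: 2
        have "\<Sigma>1 $ w $ u = \<Sigma>2 $ w $ u" if "w \<in> ?N i" for w
        proof -
          have "f i < f w" using that by (simp add: later_neighbours_def)
          then show ?thesis
            using 1[of w] 1[of u] iu sym[of w u] by (cases "f w \<le> f u") auto
        qed
        then show ?thesis using reg[OF assms(3,4) iu] reg[OF assms(5,6) iu] by simp
      qed
    qed
  qed
  have "\<Sigma>1 $ i $ j = \<Sigma>2 $ i $ j" for i j
    using eq[of i] eq[of j] sym[of i j] by (cases "f i \<le> f j") auto
  then show ?thesis by (simp add: vec_eq_iff)
qed

text \<open>The inverse of the completion is assembled from the regression coefficients and
  residuals of \<open>S\<close>.\<close>

lemma critical_point_exists:
  assumes f: "perfect_elimination E f" and S: "S \<in> sym_matrices"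
    and det: "\<And>i. det (pad (later_neighbours E f i) S) \<noteq> 0"
    and det': "\<And>i. det (pad (insert i (later_neighbours E f i)) S) \<noteq> 0"
  obtains \<Sigma> where "\<Sigma> \<in> L_inverse E" "\<And>i j. on_graph E i j \<Longrightarrow> \<Sigma> $ i $ j = S $ i $ j"
proof -
  let ?N = "later_neighbours E f"
  have S_sym: "S $ a $ b = S $ b $ a" for a b using S by (simp add: sym_matrices_iff)
  have self: "i \<notin> ?N i" for i by (simp add: later_neighbours_def)
  have "\<exists>x. pad (?N i) S *v x = regressand (?N i) i S" for i
    using cramer[OF det[of i]] by blast
  then obtain x where x: "\<And>i. pad (?N i) S *v x i = regressand (?N i) i S" by metis
  note supp = pad_support[OF x]
  have x_eq: "(\<Sum>b\<in>?N i. S $ a $ b * x i $ b) = S $ a $ i" if "a \<in> ?N i" for a i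
  proof -
    have "(pad (?N i) S *v x i) $ a = (if a \<in> ?N i then \<Sum>b\<in>?N i. S $ a $ b * x i $ b else 0)"
      by (rule pad_mult_vec[OF supp])
    then show ?thesis using that by (simp add: x regressand_def)
  qed
  \<comment> \<open>The residual variance of i given its later neighbours, a Schur complement. Were
    it 0, the vector \<open>z\<close> of 1 and negated coefficients would lie in the kernel of the
    padded submatrix on \<open>insert i (?N i)\<close>.\<close>
  define s where "s i = S $ i $ i - (\<Sum>b\<in>?N i. S $ i $ b * x i $ b)" for i
  have s: "s i \<noteq> 0" for i
  proof
    assume "s i = 0"
    define z where "z = (\<chi> a. if a = i then 1 else - x i $ a)"
    let ?W = "insert i (?N i)"
    have z_supp: "a \<notin> ?W \<Longrightarrow> z $ a = 0" for a using supp by (simp add: z_def)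
    have "(\<Sum>b\<in>?N i. S $ a $ b * z $ b) = - (\<Sum>b\<in>?N i. S $ a $ b * x i $ b)" for a
      unfolding sum_negf[symmetric] using self by (intro sum.cong) (auto simp: z_def)
    then have sum: "(\<Sum>b\<in>?W. S $ a $ b * z $ b) = S $ a $ i - (\<Sum>b\<in>?N i. S $ a $ b * x i $ b)" for a
      using self by (simp add: z_def)
    have "pad ?W S *v z = 0"
    proof (intro iffD2[OF vec_eq_iff] allI)
      fix a
      have "(\<Sum>b\<in>?W. S $ a $ b * z $ b) = 0" if "a \<in> ?W"
        using that \<open>s i = 0\<close> x_eq unfolding sum by (auto simp: s_def)
      moreover have "(pad ?W S *v z) $ a = (if a \<in> ?W then \<Sum>b\<in>?W. S $ a $ b * z $ b else 0)"
        by (rule pad_mult_vec[OF z_supp])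
      ultimately show "(pad ?W S *v z) $ a = 0 $ a" by simp
    qed
    moreover have "invertible (pad ?W S)" using det' by (simp add: invertible_det_nz)
    ultimately have "z = 0"
      using matrix_left_invertible_ker invertible_left_inverse by blast
    moreover have "z $ i = 1" by (simp add: z_def)
    ultimately show False by simp
  qed
  \<comment> \<open>Row c of \<open>L\<close> is supported on the clique of c and its later
    neighbours, so every summand of \<open>K\<close> is supported on the graph.\<close>
  define L where "L = (\<chi> i j. if j = i then 1 else - x i $ j)"
  define K where "K = LDL L (\<lambda>i. 1 / s i)"
  have L: "unitriangular f L"
    using supp by (auto simp: unitriangular_def L_def later_neighbours_def)
  obtain \<Sigma> where \<Sigma>: "K ** \<Sigma> = mat 1"
    using LDL_invertible[OF L, of "\<lambda>i. 1 / s i"] s unfolding K_def by auto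
  have L_supp: "a \<in> insert c (?N c)" if "L $ c $ a \<noteq> 0" for c a
    using that supp by (auto simp: L_def split: if_splits)
  have clique: "on_graph E a b" if "a \<in> insert c (?N c)" "b \<in> insert c (?N c)" for a b c
    using that later_neighbours_clique[OF f, of a c b]
    by (auto simp: later_neighbours_def on_graph_def insert_commute)
  have K: "K \<in> L_space E"
    unfolding L_space_iff sym_matrices_iff
  proof (intro conjI allI impI)
    fix i j
    show "K $ i $ j = K $ j $ i" by (simp add: K_def LDL_def mult_ac)
  next
    fix i j assume "\<not> on_graph E i j"
    then have "1 / s c * L $ c $ i * L $ c $ j = 0" for c
      using L_supp clique by (metis mult_eq_0_iff)
    then show "K $ i $ j = 0"
      unfolding K_def LDL_def vec_lambda_beta by (intro sum.neutral ballI)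
  qed
  then have "\<Sigma> \<in> sym_matrices" using inverse_sym[OF _ \<Sigma>] by (simp add: L_space_def)
  then have \<Sigma>_sym: "\<Sigma> $ a $ b = \<Sigma> $ b $ a" for a b by (simp add: sym_matrices_iff)
  have L\<Sigma>: "(L ** \<Sigma>) $ i $ u = \<Sigma> $ i $ u - (\<Sum>w\<in>?N i. x i $ w * \<Sigma> $ w $ u)" for i u
  proof -
    have "(L ** \<Sigma>) $ i $ u = (\<Sum>w\<in>insert i (?N i). L $ i $ w * \<Sigma> $ w $ u)"
      unfolding matrix_matrix_mult_def vec_lambda_beta
      using L_supp by (intro sum.mono_neutral_right) auto
    also have "\<dots> = \<Sigma> $ i $ u + (\<Sum>w\<in>?N i. L $ i $ w * \<Sigma> $ w $ u)"
      using self by (simp add: L_def)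
    also have "(\<Sum>w\<in>?N i. L $ i $ w * \<Sigma> $ w $ u) = - (\<Sum>w\<in>?N i. x i $ w * \<Sigma> $ w $ u)"
      unfolding sum_negf[symmetric] using self by (intro sum.cong) (auto simp: L_def)
    finally show ?thesis by simp
  qed
  have reg: "\<Sigma> $ i $ u = (if i = u then s i else 0) + (\<Sum>w\<in>?N i. x i $ w * \<Sigma> $ w $ u)" if "f i \<le> f u" for i u
    using LDL_right_inverse[OF L \<Sigma>[unfolded K_def] that] s[of i] by (auto simp: L\<Sigma> field_simps split: if_splits)
  \<comment> \<open>Entries between later neighbours agree by induction; the regression system
    \<open>x_eq\<close> then gives the entries (i, u), and the choice of \<open>s i\<close> gives
    the diagonal entry.\<close>
  have eq: "\<forall>u. u = i \<or> u \<in> ?N i \<longrightarrow> \<Sigma> $ i $ u = S $ i $ u" for i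
  proof (induction i rule: decreasing_rank_induct[where f = f])
    case (1 i)
    have N: "\<Sigma> $ w $ u = S $ w $ u" if wu: "w \<in> ?N i" "u \<in> ?N i" for w u
    proof -
      have "f i < f w" "f i < f u" using wu by (auto simp: later_neighbours_def)
      moreover have "on_graph E w u" using later_neighbours_clique[OF f wu] .
      then have "u = w \<or> u \<in> ?N w \<or> w \<in> ?N u"
        using f by (auto simp: on_graph_def later_neighbours_def perfect_elimination_def insert_commute
            dest: injD intro: linorder_neqE_nat)
      ultimately show ?thesis using 1 \<Sigma>_sym[of w u] S_sym[of w u] by auto
    qed
    have later: "\<Sigma> $ i $ u = S $ i $ u" if u: "u \<in> ?N i" for u
    proof -
      have "f i < f u" using u by (simp add: later_neighbours_def)
      then have "\<Sigma> $ i $ u = (\<Sum>w\<in>?N i. x i $ w * \<Sigma> $ w $ u)" using reg[of i u] by auto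
      also have "\<dots> = (\<Sum>w\<in>?N i. S $ u $ w * x i $ w)"
        using N[OF _ u] S_sym[of u] by (intro sum.cong) auto
      finally show ?thesis using x_eq[OF u] S_sym[of u i] by simp
    qed
    have "(\<Sum>w\<in>?N i. x i $ w * \<Sigma> $ w $ i) = (\<Sum>w\<in>?N i. S $ i $ w * x i $ w)"
      using later \<Sigma>_sym[of _ i] by (intro sum.cong) auto
    then have "\<Sigma> $ i $ i = S $ i $ i" using reg[of i i] by (simp add: s_def)
    then show ?case using later by auto
  qed
  have "\<Sigma> $ i $ j = S $ i $ j" if "on_graph E i j" for i j
  proof -
    have "j = i \<or> j \<in> ?N i \<or> i \<in> ?N j"
      using that f by (auto simp: on_graph_def later_neighbours_def perfect_elimination_def insert_commute
          dest: injD intro: linorder_neqE_nat)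
    then show ?thesis using eq[of i] eq[of j] \<Sigma>_sym[of i j] S_sym[of i j] by auto
  qed
  then show thesis using that L_inverseI[OF K \<Sigma>] by blast
qed

lemma perfect_elimination_has_ml_degree_1:
  fixes E :: "'n::finite set set"
  assumes f: "perfect_elimination E f"
  shows "has_ml_degree E 1"
proof -
  let ?N = "later_neighbours E f"
  \<comment> \<open>These are the determinants whose nonvanishing existence and uniqueness ask for.
    At the identity every padded submatrix is the identity, so \<open>p\<close> is not zero
    there.\<close>
  define p where "p S = (\<Prod>i\<in>UNIV. det (pad (?N i) S) * det (pad (insert i (?N i)) S))" for S
  have "matrix_polynomial p"
    unfolding p_def
    by (intro matrix_polynomial_prod matrix_polynomial.mult matrix_polynomial_det matrix_polynomial_pad) simp
  moreover have "pad W (mat 1) = mat 1" for W :: "'n set"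
    by (simp add: pad_def mat_def vec_eq_iff)
  then have "p (mat 1) \<noteq> 0" by (simp add: p_def)
  moreover have "mat 1 \<in> sym_matrices" by (simp add: sym_matrices_def)
  moreover have "finite (critical_points E S) \<and> card (critical_points E S) = 1"
    if S: "S \<in> sym_matrices" "p S \<noteq> 0" for S
  proof -
    have det: "det (pad (?N i) S) \<noteq> 0" "det (pad (insert i (?N i)) S) \<noteq> 0" for i
      using S(2) by (auto simp: p_def)
    obtain \<Sigma> where "\<Sigma> \<in> L_inverse E" "\<And>i j. on_graph E i j \<Longrightarrow> \<Sigma> $ i $ j = S $ i $ j"
      by (rule critical_point_exists[OF f S(1) det]) blast
    then have "critical_points E S = {\<Sigma>}"
      using critical_point_unique[OF f det(1)] by (auto simp: critical_points_iff[OF S(1)])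
    then show ?thesis by simp
  qed
  ultimately show ?thesis unfolding has_ml_degree_def for_generic_sym_def by blast
qed

theorem theorem2p4:
  fixes E :: "'n::finite set set"
  assumes "simple_graph E"
  shows "chordal E \<longleftrightarrow> ml_degree E = 1"
proof
  assume "chordal E"
  then show "ml_degree E = 1"
    using chordal_perfect_elimination[OF assms] perfect_elimination_has_ml_degree_1 ml_degree_eq_1_iff by metis
next
  assume "ml_degree E = 1"
  then have ml: "has_ml_degree E 1" using ml_degree_eq_1_iff by blast
  show "chordal E"
    unfolding chordal_def
  proof (intro allI impI, elim conjE, rule ccontr)
    fix vs assume "cycle_in E vs" "4 \<le> length vs" "\<not> has_chord E vs"
    then show False
    proof (rule chordless_cycle_critical_point)
      fix \<Sigma>0
      assume "\<Sigma>0 \<in> L_inverse E" "\<Sigma>0 \<noteq> mat 1"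
        "\<And>i j. on_graph E i j \<Longrightarrow> \<Sigma>0 $ i $ j = mat 1 $ i $ j"
      then show False using second_critical_point_not_ml_degree_1 ml by blast
    qed
  qed
qed

end
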